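(* Let $\mathbf{T}\subseteq\mathbb{N}^2$ be any tree fractal and let $c\in\mathbb{Z}^+$. Then there is no tile assembly system (at any temperature $\tau\in\mathbb{Z}^+$) that strictly self-assembles the $c$-scaling $\mathbf{T}^c$.
   Context: Discrete self-similar fractals: for $g\in\mathbb{N}$ write $\mathbb{N}_g=\{0,\dots,g-1\}$; for $A,B\subseteq\mathbb{N}^2$ and $k\in\mathbb{N}$, $A+kB=\{\vec m+k\vec n : \vec m\in A,\vec n\in B\}$. Let $1<g\in\mathbb{N}$. A set $\mathbf{X}\subset\mathbb{N}^2$ is a $g$-discrete self-similar fractal ($g$-dssf) if there is a set $G$ with $\{(0,0)\}\subsetneq G\subsetneq\mathbb{N}_g^2$ having at least one point in every row and every column of $\mathbb{N}_g^2$ such that $\mathbf{X}=\bigcup_{i\ge1}X_i$, where $X_1=G$ and $X_{i+1}=X_i+g^iG$; $G$ is the generator. The full grid graph of $V\subseteq\mathbb{Z}^2$ has vertex set $V$ and an edge between $\vec x,\vec y\in V$ iff $\|\vec x-\vec y\|=1$. A tree fractal is a $g$-dssf (for some $g>1$) whose full grid graph is a tree (connected and acyclic). For $X\subseteq\mathbb{Z}^2$ and $c\in\mathbb{Z}^+$, the $c$-scaling is $X^c=\{(x,y)\in\mathbb{Z}^2 : (\lfloor x/c\rfloor,\lfloor y/c\rfloor)\in X\}$. Abstract Tile Assembly Model (aTAM): A glue is a pair (label in $\Sigma^*$, strength in $\mathbb{N}$). A tile type is a 4-tuple of glues, one for each side (N, E, S, W) of a unit square; a tile set $T$ is a finite set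 of tile types (with unlimited copies). A configuration is a partial function $\alpha:\mathbb{Z}^2\dashrightarrow T$. Two tiles at adjacent positions interact if the glues on their abutting sides are equal in label and strength and have positive strength; the binding graph of $\alpha$ has vertex set $\mathrm{dom}\,\alpha$ with edges between interacting tiles, weighted by glue strength. An assembly is a configuration with nonempty domain whose domain has connected full grid graph. Given $\tau\in\mathbb{Z}^+$, $\alpha$ is $\tau$-stable if every cut of its binding graph has total weight at least $\tau$. $\alpha\sqsubseteq\beta$ means $\mathrm{dom}\,\alpha\subseteq\mathrm{dom}\,\beta$ and $\alpha,\beta$ agree on $\mathrm{dom}\,\alpha$. A tile assembly system (TAS) is $\mathcal{T}=(T,\sigma,\tau)$ with $T$ a tile set, $\sigma$ a finite $\tau$-stable seed assembly, and temperature $\tau\in\mathbb{Z}^+$. For $\tau$-stable $\alpha,\beta$, $\alpha\to_1\beta$ if $\alpha\sqsubseteq\beta$ and $|\mathrm{dom}\,\beta\setminus\mathrm{dom}\,\alpha|=1$. An assembly sequence is a finite or infinite sequence $\alpha_0,\alpha_1,\dots$ with $\alpha_{i-1}\to_1\alpha_i$; its result is the limit (union). An assembly is producible if it is the result of an assembly sequence starting from $\sigma$; it is terminal if it is $\tau$-stable and no tile can be added to it to yield a $\tau$-stable assembly. $\mathcal{T}$ strictly self-assembles $X\subseteq\mathbb{Z}^2$ if every producible terminal assembly $\alpha$ satisfies $\mathrm{dom}\,\alpha=X$. *)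

theory Defs
  imports Main
begin

section \<open>Discrete self-similar fractals and tree fractals\<close>

definition set_plus_scaled :: "(nat \<times> nat) set \<Rightarrow> nat \<Rightarrow> (nat \<times> nat) set \<Rightarrow> (nat \<times> nat) set" where
  "set_plus_scaled A k B = {(fst m + k * fst n, snd m + k * snd n) | m n. m \<in> A \<and> n \<in> B}"

definition is_generator :: "nat \<Rightarrow> (nat \<times> nat) set \<Rightarrow> bool" where
  "is_generator g G \<longleftrightarrow>
     {(0,0)} \<subset> G \<and> G \<subset> {0..<g} \<times> {0..<g} \<and>
     (\<forall>y<g. \<exists>x. (x, y) \<in> G) \<and> (\<forall>x<g. \<exists>y. (x, y) \<in> G)"

text \<open>dssf_stage g G i is X_(i+1): X_1 = G and X_(i+1) = X_i + g^i G.\<close>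
fun dssf_stage :: "nat \<Rightarrow> (nat \<times> nat) set \<Rightarrow> nat \<Rightarrow> (nat \<times> nat) set" where
  "dssf_stage g G 0 = G"
| "dssf_stage g G (Suc i) = set_plus_scaled (dssf_stage g G i) (g ^ Suc i) G"

definition is_dssf :: "nat \<Rightarrow> (nat \<times> nat) set \<Rightarrow> bool" where
  "is_dssf g X \<longleftrightarrow> 1 < g \<and> (\<exists>G. is_generator g G \<and> X = (\<Union>i. dssf_stage g G i))"

definition grid_adj :: "int \<times> int \<Rightarrow> int \<times> int \<Rightarrow> bool" where
  "grid_adj p q \<longleftrightarrow> \<bar>fst p - fst q\<bar> + \<bar>snd p - snd q\<bar> = 1"

definition grid_edges :: "(int \<times> int) set \<Rightarrow> ((int \<times> int) \<times> (int \<times> int)) set" where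
  "grid_edges V = {(p, q). p \<in> V \<and> q \<in> V \<and> grid_adj p q}"

definition grid_connected :: "(int \<times> int) set \<Rightarrow> bool" where
  "grid_connected V \<longleftrightarrow> (\<forall>p\<in>V. \<forall>q\<in>V. (p, q) \<in> (grid_edges V)\<^sup>*)"

text \<open>A cycle in the (simple, undirected) full grid graph: distinct vertices
  v_0, ..., v_k (k >= 2) of V, consecutive ones adjacent and v_k adjacent to v_0.\<close>
definition grid_acyclic :: "(int \<times> int) set \<Rightarrow> bool" where
  "grid_acyclic V \<longleftrightarrow> \<not> (\<exists>vs. length vs \<ge> 3 \<and> distinct vs \<and> set vs \<subseteq> V \<and>
       (\<forall>i. Suc i < length vs \<longrightarrow> grid_adj (vs ! i) (vs ! Suc i)) \<and>
       grid_adj (last vs) (hd vs))"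

definition grid_tree :: "(int \<times> int) set \<Rightarrow> bool" where
  "grid_tree V \<longleftrightarrow> grid_connected V \<and> grid_acyclic V"

definition embZ :: "nat \<times> nat \<Rightarrow> int \<times> int" where
  "embZ p = (int (fst p), int (snd p))"

definition tree_fractal :: "(nat \<times> nat) set \<Rightarrow> bool" where
  "tree_fractal X \<longleftrightarrow> (\<exists>g. is_dssf g X) \<and> grid_tree (embZ ` X)"

text \<open>c-scaling; div on int is floor division.\<close>
definition scaling :: "int \<Rightarrow> (int \<times> int) set \<Rightarrow> (int \<times> int) set" where
  "scaling c X = {(x, y). (x div c, y div c) \<in> X}"

section \<open>Abstract Tile Assembly Model\<close>

type_synonym 'l glue = "'l list \<times> nat"
text \<open>Tile type: glues on the (N, E, S, W) sides.\<close>
type_synonym 'l tile = "'l glue \<times> 'l glue \<times> 'l glue \<times> 'l glue"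
type_synonym 'l config = "int \<times> int \<Rightarrow> 'l tile option"

definition glueN :: "'l tile \<Rightarrow> 'l glue" where "glueN t = fst t"
definition glueE :: "'l tile \<Rightarrow> 'l glue" where "glueE t = fst (snd t)"
definition glueS :: "'l tile \<Rightarrow> 'l glue" where "glueS t = fst (snd (snd t))"
definition glueW :: "'l tile \<Rightarrow> 'l glue" where "glueW t = snd (snd (snd t))"

text \<open>Weight of the binding-graph edge between positions p and q (0 if they do not interact).\<close>
definition bond :: "'l config \<Rightarrow> int \<times> int \<Rightarrow> int \<times> int \<Rightarrow> nat" where
  "bond \<alpha> p q = (case (\<alpha> p, \<alpha> q) of
     (Some t, Some t') \<Rightarrow>
       if q = (fst p, snd p + 1) \<and> glueN t = glueS t' then snd (glueN t)
       else if q = (fst p + 1, snd p) \<and> glueE t = glueW t' then snd (glueE t)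
       else if q = (fst p, snd p - 1) \<and> glueS t = glueN t' then snd (glueS t)
       else if q = (fst p - 1, snd p) \<and> glueW t = glueE t' then snd (glueW t)
       else 0
   | _ \<Rightarrow> 0)"

definition is_assembly :: "'l config \<Rightarrow> bool" where
  "is_assembly \<alpha> \<longleftrightarrow> dom \<alpha> \<noteq> {} \<and> grid_connected (dom \<alpha>)"

text \<open>The (possibly infinite) total weight of the cut (A, dom - A) is at least tau
  iff some finite set of edges crossing the cut has total weight at least tau.\<close>
definition tau_stable :: "nat \<Rightarrow> 'l config \<Rightarrow> bool" where
  "tau_stable \<tau> \<alpha> \<longleftrightarrow>
     (\<forall>A. A \<subseteq> dom \<alpha> \<and> A \<noteq> {} \<and> A \<noteq> dom \<alpha> \<longrightarrow>
        (\<exists>F. finite F \<and> F \<subseteq> {(p, q). p \<in> A \<and> q \<in> dom \<alpha> - A} \<and>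
             \<tau> \<le> (\<Sum>(p, q)\<in>F. bond \<alpha> p q)))"

definition stable_assembly :: "'l tile set \<Rightarrow> nat \<Rightarrow> 'l config \<Rightarrow> bool" where
  "stable_assembly T \<tau> \<alpha> \<longleftrightarrow> ran \<alpha> \<subseteq> T \<and> is_assembly \<alpha> \<and> tau_stable \<tau> \<alpha>"

definition step1 :: "'l tile set \<Rightarrow> nat \<Rightarrow> 'l config \<Rightarrow> 'l config \<Rightarrow> bool" where
  "step1 T \<tau> \<alpha> \<beta> \<longleftrightarrow> stable_assembly T \<tau> \<alpha> \<and> stable_assembly T \<tau> \<beta> \<and>
     \<alpha> \<subseteq>\<^sub>m \<beta> \<and> card (dom \<beta> - dom \<alpha>) = 1"

text \<open>Result (limit) of an infinite assembly sequence.\<close>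
definition seq_result :: "(nat \<Rightarrow> 'l config) \<Rightarrow> 'l config" where
  "seq_result f = (\<lambda>p. if \<exists>i. f i p \<noteq> None then f (SOME i. f i p \<noteq> None) p else None)"

definition producible :: "'l tile set \<Rightarrow> 'l config \<Rightarrow> nat \<Rightarrow> 'l config \<Rightarrow> bool" where
  "producible T \<sigma> \<tau> \<alpha> \<longleftrightarrow>
     (\<exists>n f. f 0 = \<sigma> \<and> (\<forall>i<n. step1 T \<tau> (f i) (f (Suc i))) \<and> \<alpha> = f n) \<or>
     (\<exists>f. f 0 = \<sigma> \<and> (\<forall>i. step1 T \<tau> (f i) (f (Suc i))) \<and> \<alpha> = seq_result f)"

definition terminal :: "'l tile set \<Rightarrow> nat \<Rightarrow> 'l config \<Rightarrow> bool" where
  "terminal T \<tau> \<alpha> \<longleftrightarrow> stable_assembly T \<tau> \<alpha> \<and>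
     \<not> (\<exists>p t. p \<notin> dom \<alpha> \<and> t \<in> T \<and> stable_assembly T \<tau> (\<alpha>(p \<mapsto> t)))"

definition is_TAS :: "'l tile set \<Rightarrow> 'l config \<Rightarrow> nat \<Rightarrow> bool" where
  "is_TAS T \<sigma> \<tau> \<longleftrightarrow> finite T \<and> 0 < \<tau> \<and> finite (dom \<sigma>) \<and> stable_assembly T \<tau> \<sigma>"

definition strictly_self_assembles :: "'l tile set \<Rightarrow> 'l config \<Rightarrow> nat \<Rightarrow> (int \<times> int) set \<Rightarrow> bool" where
  "strictly_self_assembles T \<sigma> \<tau> X \<longleftrightarrow>
     (\<forall>\<alpha>. producible T \<sigma> \<tau> \<alpha> \<and> terminal T \<tau> \<alpha> \<longrightarrow> dom \<alpha> = X)"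

end

theory Submission
  imports Defs "HOL-Library.Product_Plus" "HOL-Library.Nat_Bijection"
begin

text \<open>
  Root the tree \<open>V\<close> and suppose that its scaling is assembled. Cut the scaled shape along the single edge
  above a vertex \<open>p\<close> and record the tiles, with their order of placement, on the two cells at that edge.
  There are only finitely many such movies. If \<open>p\<close> and \<open>p'\<close>, both deep enough to have no seed tile below
  them, have the same movie, then their subtrees are translates of each other: otherwise the growth below
  one of them can be replayed below the other until it first leaves the shape there.

  Hence every infinite branch contains vertices \<open>p\<close> and \<open>p + v\<close> whose subtrees are translates. The
  part of the subtree of \<open>p\<close> outside the subtree of \<open>p + v\<close> cannot be finite along a branch of superlinear
  growth, so it contains an infinite branch, which repeats with some period \<open>w\<close>. Acyclicity makes \<open>v\<close> and
  \<open>w\<close> independent, so \<open>V\<close> contains a two-dimensional lattice cone. A self-similar fractal has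
  superlinear growth, as its generator has more than \<open>g\<close> points, but it contains no such cone, as its
  holes are arbitrarily large.
\<close>

section \<open>Rooted trees in the grid\<close>

text \<open>Strict self-assembly constrains terminal assemblies only, whereas the replay yields a
  finite growth with one tile off the shape. The bridge is a fair completion: every reachable
  assembly extends to a terminal producible one and so lies inside the shape. The obstacle of the
  replay is that the growth below \<open>p\<close> and the growth below \<open>p'\<close> happened
  at unrelated times of one history. Only the order of events at the two windows is common to both,
  so the number of port tiles already present serves as a shared clock. A window of two cells is
  enough because a subtree touches the rest of the tree along one edge only; for fixed
  \<open>c\<close> it has finitely many positions. Linear growth and finiteness outside a fixed set
  are treated alike, as notions of smallness passing to finite unions, for which a Koenig argument
  finds branches: first one whose subtrees all grow superlinearly, then one whose subtrees stay
  infinite off the subtree of \<open>p + v\<close>. Acyclicity yields independence of the periods in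
  this form: parallel ones would put one point into two disjoint subtrees.\<close>

definition nbs :: "int \<times> int \<Rightarrow> (int \<times> int) set" where
  "nbs p = {q. grid_adj p q}"

lemma nbs_eq: "nbs (x, y) = {(x, y + 1), (x + 1, y), (x, y - 1), (x - 1, y)}"
  unfolding nbs_def grid_adj_def by auto

lemma finite_nbs [simp]: "finite (nbs p)"
  by (cases p) (simp add: nbs_eq)

lemma grid_adj_commute: "grid_adj p q \<longleftrightarrow> grid_adj q p"
  unfolding grid_adj_def by (simp add: abs_minus_commute)

lemma grid_adj_neq: "grid_adj p q \<Longrightarrow> p \<noteq> q"
  unfolding grid_adj_def by auto

locale rooted_grid_tree =
  fixes V :: "(int \<times> int) set" and r :: "int \<times> int"
  assumes tree: "grid_tree V" and root: "r \<in> V"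
begin

definition depth :: "int \<times> int \<Rightarrow> nat" where
  "depth p = (LEAST n. (r, p) \<in> grid_edges V ^^ n)"

definition par :: "int \<times> int \<Rightarrow> int \<times> int" where
  "par p = (SOME q. q \<in> V \<and> grid_adj q p \<and> depth p = Suc (depth q))"

text \<open>The root is excluded because \<open>par r\<close> is an arbitrary value.\<close>

definition child :: "((int \<times> int) \<times> (int \<times> int)) set" where
  "child = {(a, b). a \<in> V \<and> b \<in> V \<and> b \<noteq> r \<and> par b = a}"

definition desc :: "int \<times> int \<Rightarrow> (int \<times> int) set" where
  "desc p = child\<^sup>* `` {p}"

lemma depth_path:
  assumes "p \<in> V" shows "(r, p) \<in> grid_edges V ^^ depth p"
proof -
  have "(r, p) \<in> (grid_edges V)\<^sup>*"
    using tree root assms unfolding grid_tree_def grid_connected_def by blast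
  then show ?thesis
    unfolding depth_def by (meson LeastI rtrancl_imp_relpow)
qed

lemma depth_root: "depth r = 0"
  unfolding depth_def by (rule Least_equality) auto

text \<open>The last vertex before \<open>p\<close> on a shortest path from \<open>r\<close> works:
  the rest of that path bounds its depth from above, and one more edge to \<open>p\<close> bounds it
  from below.\<close>

lemma par_exists:
  assumes "p \<in> V" "p \<noteq> r"
  shows "\<exists>q. q \<in> V \<and> grid_adj q p \<and> depth p = Suc (depth q)"
proof -
  obtain n where n: "depth p = Suc n"
    using depth_path[OF assms(1)] assms(2) by (cases "depth p") auto
  obtain q where q: "(r, q) \<in> grid_edges V ^^ n" "(q, p) \<in> grid_edges V"
    using depth_path[OF assms(1)] unfolding n by auto
  have qV: "q \<in> V" "grid_adj q p"
    using q(2) unfolding grid_edges_def by auto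
  have "depth q \<le> n"
    unfolding depth_def using q(1) by (rule Least_le)
  moreover have "depth p \<le> Suc (depth q)"
    unfolding depth_def[of p] using depth_path[OF qV(1)] q(2) by (intro Least_le) auto
  ultimately have "depth p = Suc (depth q)" using n by simp
  then show ?thesis using qV by blast
qed

lemma par:
  assumes "p \<in> V" "p \<noteq> r"
  shows "par p \<in> V" "grid_adj (par p) p" "depth p = Suc (depth (par p))"
  using someI_ex[OF par_exists[OF assms]] unfolding par_def by auto

lemma child_depth: "(a, b) \<in> child \<Longrightarrow> depth b = Suc (depth a)"
  unfolding child_def using par by auto

lemma child_adj: "(a, b) \<in> child \<Longrightarrow> grid_adj a b"
  unfolding child_def using par(2) by blast

lemma chain:
  assumes "p \<in> V" "i \<le> depth p"
  shows "(par ^^ i) p \<in> V \<and> depth ((par ^^ i) p) = depth p - i"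
  using assms(2)
proof (induction i)
  case 0
  then show ?case using assms by simp
next
  case (Suc i)
  then have "(par ^^ i) p \<in> V" "depth ((par ^^ i) p) = depth p - i" by auto
  moreover from this have "(par ^^ i) p \<noteq> r" using Suc.prems depth_root by auto
  ultimately show ?case using par[of "(par ^^ i) p"] by auto
qed

lemma chain_end:
  assumes "p \<in> V" shows "(par ^^ depth p) p = r"
proof (rule ccontr)
  assume "(par ^^ depth p) p \<noteq> r"
  then show False using par(3)[of "(par ^^ depth p) p"] chain[OF assms, of "depth p"] by auto
qed

lemma chain_adj:
  assumes "p \<in> V" "i < depth p"
  shows "grid_adj ((par ^^ i) p) ((par ^^ Suc i) p)"
proof -
  have "(par ^^ i) p \<noteq> r" using chain[OF assms(1), of i] assms(2) depth_root by auto
  then show ?thesis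
    using par(2)[of "(par ^^ i) p"] chain[OF assms(1), of i] assms(2) by (auto simp: grid_adj_commute)
qed

lemma chain_inj:
  assumes "p \<in> V" "i \<le> depth p" "j \<le> depth p" "(par ^^ i) p = (par ^^ j) p"
  shows "i = j"
  using chain[OF assms(1,2)] chain[OF assms(1,3)] assms by (metis diff_diff_cancel)

text \<open>If neither endpoint of an edge were the parent of the other, the two chains of ancestors up to
  their first meeting point would close up to a cycle.\<close>
lemma adj_child:
  assumes p: "p \<in> V" and q: "q \<in> V" and adj: "grid_adj p q"
  shows "(p, q) \<in> child \<or> (q, p) \<in> child"
proof (rule ccontr)
  assume neg: "\<not> ((p, q) \<in> child \<or> (q, p) \<in> child)"
  define P where "P i \<longleftrightarrow> (\<exists>j\<le>depth q. (par ^^ i) p = (par ^^ j) q)" for i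
  define m where "m = (LEAST i. P i)"
  have "P (depth p)"
    unfolding P_def using chain_end[OF p] chain_end[OF q] by (intro exI[of _ "depth q"]) simp
  then have Pm: "P m" and m_le: "m \<le> depth p"
    unfolding m_def by (auto intro: LeastI Least_le)
  have m_min: "\<not> P i" if "i < m" for i
    using that not_less_Least unfolding m_def by blast
  obtain j where j: "j \<le> depth q" "(par ^^ m) p = (par ^^ j) q"
    using Pm unfolding P_def by auto
  \<comment> \<open>The cycle climbs from \<open>p\<close> to the meeting point (\<open>as\<close>)
    and comes down to \<open>q\<close> (\<open>bs\<close>). The meeting point is counted in
    \<open>as\<close> only, so \<open>bs\<close> is empty if it is \<open>q\<close> itself.\<close>
  define as where "as = map (\<lambda>i. (par ^^ i) p) [0..<Suc m]"
  define bs where "bs = map (\<lambda>i. (par ^^ i) q) (rev [0..<j])"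
  have la: "length as = Suc m" and lb: "length bs = j"
    unfolding as_def bs_def by auto
  have as_nth: "as ! i = (par ^^ i) p" if "i \<le> m" for i
    using that unfolding as_def by (simp del: upt_Suc)
  have bs_nth: "bs ! i = (par ^^ (j - Suc i)) q" if "i < j" for i
    using that unfolding bs_def by (simp add: rev_nth)
  \<comment> \<open>Fewer than three vertices would mean that \<open>p = q\<close> or that one of
    the two is the parent of the other.\<close>
  have long: "m + j \<ge> 2"
  proof (rule ccontr)
    assume "\<not> m + j \<ge> 2"
    then consider "m = 0" "j = 0" | "m = 0" "j = 1" | "m = 1" "j = 0" by linarith
    then show False
    proof cases
      case 1
      then show False using j grid_adj_neq[OF adj] by simp
    next
      case 2
      then have "q \<noteq> r" "par q = p" using j depth_root by auto
      then show False using neg p q unfolding child_def by auto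
    next
      case 3
      then have "p \<noteq> r" "par p = q" using j m_le depth_root by auto
      then show False using neg p q unfolding child_def by auto
    qed
  qed
  have dist: "distinct (as @ bs)"
  proof -
    have "distinct as"
      unfolding as_def distinct_map using chain_inj[OF p] m_le by (auto simp: inj_on_def simp del: upt_Suc)
    moreover have "distinct bs"
      unfolding bs_def distinct_map using chain_inj[OF q] j by (auto simp: inj_on_def)
    moreover have "set as \<inter> set bs = {}"
    proof -
      have "(par ^^ i) p \<noteq> (par ^^ k) q" if "i \<le> m" "k < j" for i k
      proof
        assume eq: "(par ^^ i) p = (par ^^ k) q"
        then have "P i" unfolding P_def using that j by (intro exI[of _ k]) auto
        then have "i = m" using m_min that by (metis le_neq_implies_less)
        then have "(par ^^ k) q = (par ^^ j) q" using eq j by simp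
        then show False using chain_inj[OF q, of k j] that j by auto
      qed
      moreover have "set as = (\<lambda>i. (par ^^ i) p) ` {..m}" "set bs = (\<lambda>i. (par ^^ i) q) ` {..<j}"
        unfolding as_def bs_def by (auto simp del: upt_Suc simp: less_Suc_eq_le)
      ultimately show ?thesis by (simp add: disjoint_iff image_iff Ball_def Bex_def) metis
    qed
    ultimately show ?thesis by simp
  qed
  have sub: "set (as @ bs) \<subseteq> V"
    using chain[OF p] chain[OF q] m_le j unfolding as_def bs_def by (auto simp del: upt_Suc)
  have steps: "grid_adj ((as @ bs) ! i) ((as @ bs) ! Suc i)" if "Suc i < length (as @ bs)" for i
  proof -
    have i: "Suc i < Suc m + j" using that la lb by simp
    consider "i < m" | "i = m" | "i > m" by linarith
    then show ?thesis
    proof cases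
      case 1
      then have "(as @ bs) ! i = (par ^^ i) p" "(as @ bs) ! Suc i = (par ^^ Suc i) p"
        using la as_nth by (auto simp: nth_append simp del: funpow.simps)
      then show ?thesis using chain_adj[OF p, of i] 1 m_le by simp
    next
      case 2
      then have "(as @ bs) ! i = (par ^^ j) q" "(as @ bs) ! Suc i = (par ^^ (j - 1)) q"
        using la as_nth bs_nth i j by (auto simp: nth_append simp del: funpow.simps)
      then show ?thesis using chain_adj[OF q, of "j - 1"] 2 i j by (auto simp: grid_adj_commute)
    next
      case 3
      define k where "k = j - Suc (i - m)"
      have "(as @ bs) ! i = (par ^^ Suc k) q" "(as @ bs) ! Suc i = (par ^^ k) q"
        unfolding k_def using 3 la as_nth bs_nth i j
        by (auto simp: nth_append Suc_diff_Suc Suc_diff_le simp del: funpow.simps)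
      moreover have "k < depth q" unfolding k_def using i 3 j by auto
      ultimately show ?thesis using chain_adj[OF q, of k] grid_adj_commute by metis
    qed
  qed
  have "grid_adj (last (as @ bs)) (hd (as @ bs))"
  proof -
    have hd: "hd (as @ bs) = p" unfolding as_def by (simp add: upt_rec)
    have "last (as @ bs) = q"
    proof (cases j)
      case 0
      have "as \<noteq> []" using la by auto
      then show ?thesis using 0 j la as_nth[of m] by (simp add: bs_def last_conv_nth)
    next
      case (Suc k)
      then have "bs \<noteq> []" using lb by auto
      then show ?thesis using Suc bs_nth[of k] lb by (simp add: last_conv_nth)
    qed
    then show ?thesis using adj hd grid_adj_commute by simp
  qed
  then have "\<not> grid_acyclic V"
    unfolding grid_acyclic_def using dist sub steps long la lb
    by (intro notI, elim notE, intro exI[of _ "as @ bs"]) auto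
  then show False using tree unfolding grid_tree_def by simp
qed

section \<open>Subtrees and infinite branches\<close>

lemma self_desc [simp]: "p \<in> desc p"
  unfolding desc_def by simp

lemma desc_subset: "p \<in> V \<Longrightarrow> desc p \<subseteq> V"
proof
  fix q assume "p \<in> V" "q \<in> desc p"
  then have "(p, q) \<in> child\<^sup>*" unfolding desc_def by simp
  then show "q \<in> V" using \<open>p \<in> V\<close> by (induction) (auto simp: child_def)
qed

lemma desc_trans: "q \<in> desc p \<Longrightarrow> desc q \<subseteq> desc p"
  unfolding desc_def by auto

lemma desc_depth: "q \<in> desc p \<Longrightarrow> depth p \<le> depth q"
proof -
  assume "q \<in> desc p"
  then have "(p, q) \<in> child\<^sup>*" unfolding desc_def by simp
  then show ?thesis by (induction) (auto dest: child_depth)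
qed

lemma desc_root: "desc r = V"
proof
  show "desc r \<subseteq> V" by (rule desc_subset[OF root])
  show "V \<subseteq> desc r"
  proof
    fix p assume "p \<in> V"
    then show "p \<in> desc r"
    proof (induction "depth p" arbitrary: p)
      case 0
      then show ?case using chain_end[of p] by simp
    next
      case (Suc n)
      then have "p \<noteq> r" using depth_root by auto
      then have "(par p, p) \<in> child" "par p \<in> desc r"
        using par[of p] Suc unfolding child_def by auto
      then show ?case unfolding desc_def by auto
    qed
  qed
qed

lemma child_unique: "(a, c) \<in> child \<Longrightarrow> (b, c) \<in> child \<Longrightarrow> a = b"
  unfolding child_def by auto

text \<open>Parents are unique, so two ancestors of a common descendant lie on one upward chain and
  are comparable.\<close>

lemma desc_disjoint:
  assumes "p \<notin> desc q" "q \<notin> desc p"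
  shows "desc p \<inter> desc q = {}"
proof (rule ccontr)
  assume "desc p \<inter> desc q \<noteq> {}"
  then obtain z where "(z, p) \<in> (child\<inverse>)\<^sup>*" "(z, q) \<in> (child\<inverse>)\<^sup>*"
    unfolding desc_def by (auto simp: rtrancl_converse)
  moreover have "single_valued (child\<inverse>)"
    using child_unique by (auto intro: single_valuedI)
  ultimately have "(p, q) \<in> (child\<inverse>)\<^sup>* \<or> (q, p) \<in> (child\<inverse>)\<^sup>*"
    using single_valued_confluent by metis
  then show False using assms unfolding desc_def by (auto simp: rtrancl_converse)
qed

text \<open>Every edge joins a vertex to its parent, so an edge leaving a subtree can only be the
  one above its root.\<close>

lemma desc_exit:
  assumes "p \<in> V" "q \<in> desc p" "q' \<in> V - desc p" "grid_adj q q'"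
  shows "q = p \<and> (q', p) \<in> child"
proof -
  have pq: "(p, q) \<in> child\<^sup>*" using assms unfolding desc_def by auto
  have "q \<in> V" using desc_subset assms by blast
  then have "(q, q') \<in> child \<or> (q', q) \<in> child" using adj_child assms by auto
  moreover have "(q, q') \<notin> child" using assms pq unfolding desc_def by (auto intro: rtrancl_into_rtrancl)
  ultimately have c: "(q', q) \<in> child" by simp
  from pq show ?thesis
  proof (cases rule: rtranclE)
    case base
    then show ?thesis using c by simp
  next
    case (step x)
    then have "x = q'" using c child_unique by blast
    then show ?thesis using step assms unfolding desc_def by auto
  qed
qed

lemma desc_unfold: "desc p = insert p (\<Union>b\<in>child `` {p}. desc b)"
  unfolding desc_def by (auto elim: converse_rtranclE intro: converse_rtrancl_into_rtrancl)

lemma finite_children: "finite (child `` {p})"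
  by (rule finite_subset[OF _ finite_nbs[of p]]) (auto simp: nbs_def child_adj)

text \<open>Koenig's lemma for any notion of smallness that holds for singletons and passes to
  finite unions: by finite branching, a vertex whose subtree is not small has a child of the same
  kind.\<close>

lemma ray_exists:
  assumes single: "\<And>p. small {p}"
    and union: "\<And>A B. small A \<Longrightarrow> small B \<Longrightarrow> small (A \<union> B)"
    and big: "p \<in> V" "\<not> small (desc p)"
  shows "\<exists>x. x 0 = p \<and> (\<forall>i. x i \<in> V \<and> (x i, x (Suc i)) \<in> child \<and> \<not> small (desc (x i)))"
proof -
  have fin: "small (insert p (\<Union>b\<in>B. desc b))" if "finite B" "\<forall>b\<in>B. small (desc b)" for p B
    using that
  proof (induction B)
    case empty
    then show ?case using single by simp
  next
    case (insert b B)
    have "insert p (\<Union>b\<in>insert b B. desc b) = insert p (\<Union>b\<in>B. desc b) \<union> desc b" by auto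
    then show ?case using union insert by (simp del: Un_insert_left)
  qed
  have ex: "\<exists>y. y \<in> V \<and> \<not> small (desc y) \<and> (x, y) \<in> child"
    if "x \<in> V" "\<not> small (desc x)" for x
    using fin[OF finite_children, of x x] desc_unfold[of x] that unfolding child_def by auto
  have "\<exists>f. \<forall>n. (f n \<in> V \<and> \<not> small (desc (f n)) \<and> (n = 0 \<longrightarrow> f n = p)) \<and> (f n, f (Suc n)) \<in> child"
    by (rule dependent_nat_choice) (use big ex in blast)+
  then obtain f where f: "\<And>n. (f n \<in> V \<and> \<not> small (desc (f n)) \<and> (n = 0 \<longrightarrow> f n = p)) \<and> (f n, f (Suc n)) \<in> child"
    by blast
  then show ?thesis by (intro exI[of _ f]) simp
qed

lemma ray_depth:
  assumes "\<And>i. (x i, x (Suc i)) \<in> child" shows "depth (x i) = depth (x 0) + i"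
  by (induction i) (auto simp: child_depth[OF assms])

lemma ray_desc:
  assumes "\<And>i. (x i, x (Suc i)) \<in> child" "i \<le> j" shows "x j \<in> desc (x i)"
  using assms(2)
proof (induction j rule: dec_induct)
  case (step n)
  then show ?case using assms(1)[of n] unfolding desc_def by (auto intro: rtrancl_into_rtrancl)
qed simp

end

section \<open>Attaching tiles\<close>

declare split_paired_All [simp del] split_paired_Ex [simp del]

lemma map_leD: "f \<subseteq>\<^sub>m g \<Longrightarrow> f x = Some v \<Longrightarrow> g x = Some v"
  unfolding map_le_def by (metis domI)

lemma map_leI: "(\<And>x v. f x = Some v \<Longrightarrow> g x = Some v) \<Longrightarrow> f \<subseteq>\<^sub>m g"
  unfolding map_le_def by (metis domD)

lemma bond_outside: "\<alpha> p = None \<or> \<alpha> q = None \<Longrightarrow> bond \<alpha> p q = 0"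
  unfolding bond_def by (auto split: option.splits)

lemma bond_not_adj: "q \<notin> nbs p \<Longrightarrow> bond \<alpha> p q = 0"
  by (cases p; cases q) (auto simp: bond_def nbs_eq split: option.splits)

lemma bond_commute: "bond \<alpha> p q = bond \<alpha> q p"
  by (cases p; cases q) (auto simp: bond_def split: option.splits)

lemma bond_cong: "\<alpha> p = \<beta> p \<Longrightarrow> \<alpha> q = \<beta> q \<Longrightarrow> bond \<alpha> p q = bond \<beta> p q"
  unfolding bond_def by simp

lemma bond_translate:
  assumes "\<beta> (p + s) = \<alpha> p" "\<beta> (q + s) = \<alpha> q"
  shows "bond \<beta> (p + s) (q + s) = bond \<alpha> p q"
  using assms by (cases p; cases q; cases s) (auto simp: bond_def split: option.splits)

lemma stable_assemblyD:
  assumes "stable_assembly T \<tau> \<alpha>"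
  shows "ran \<alpha> \<subseteq> T" "dom \<alpha> \<noteq> {}" "grid_connected (dom \<alpha>)" "tau_stable \<tau> \<alpha>"
  using assms by (simp_all add: stable_assembly_def is_assembly_def)

lemma grid_connected_insert:
  assumes "grid_connected V" "q \<in> V" "grid_adj q z"
  shows "grid_connected (insert z V)"
proof -
  let ?E = "grid_edges (insert z V)"
  have V: "(a, b) \<in> ?E\<^sup>*" if "a \<in> V" "b \<in> V" for a b
  proof -
    have "(grid_edges V)\<^sup>* \<subseteq> ?E\<^sup>*"
      by (rule rtrancl_mono) (auto simp: grid_edges_def)
    then show ?thesis using assms that unfolding grid_connected_def by blast
  qed
  have "(q, z) \<in> ?E" "(z, q) \<in> ?E"
    using assms grid_adj_commute unfolding grid_edges_def by auto
  then have "(a, z) \<in> ?E\<^sup>*" "(z, a) \<in> ?E\<^sup>*" if "a \<in> V" for a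
    using V[OF that assms(2)] V[OF assms(2) that]
    by (auto intro: rtrancl_into_rtrancl converse_rtrancl_into_rtrancl)
  then show ?thesis using V unfolding grid_connected_def by auto
qed

definition binding :: "'l config \<Rightarrow> int \<times> int \<Rightarrow> nat" where
  "binding \<alpha> z = (\<Sum>q\<in>nbs z. bond \<alpha> z q)"

lemma binding_inter:
  "binding \<alpha> z = (\<Sum>q\<in>nbs z \<inter> dom \<alpha>. bond \<alpha> z q)"
  unfolding binding_def by (rule sum.mono_neutral_right) (auto simp: bond_outside domIff)

text \<open>A cut of the enlarged assembly either separates \<open>z\<close> from everything else,
  where \<open>binding\<close> measures it, or restricts to a proper cut of the old assembly.
  Together with \<open>stable_binding\<close>, attachment becomes a condition on the neighbours of
  \<open>z\<close> alone.\<close>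

lemma stable_attach:
  assumes st: "stable_assembly T \<tau> \<gamma>" and z: "z \<notin> dom \<gamma>" and t: "t \<in> T" and "0 < \<tau>"
    and b: "\<tau> \<le> binding (\<gamma>(z \<mapsto> t)) z"
  shows "stable_assembly T \<tau> (\<gamma>(z \<mapsto> t))"
proof -
  let ?\<delta> = "\<gamma>(z \<mapsto> t)"
  have zz: "z \<notin> nbs z" by (cases z) (simp add: nbs_eq)
  have zN: "\<gamma> z = None" using z by auto
  have inter: "nbs z \<inter> dom ?\<delta> = nbs z \<inter> dom \<gamma>" using zz by auto
  have bsum: "\<tau> \<le> (\<Sum>q\<in>nbs z \<inter> dom \<gamma>. bond ?\<delta> z q)"
    using b binding_inter[of ?\<delta> z] inter by simp
  have "ran ?\<delta> \<subseteq> T" using st t zN unfolding stable_assembly_def by (auto simp: ran_map_upd)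
  moreover have "is_assembly ?\<delta>"
  proof -
    have "nbs z \<inter> dom \<gamma> \<noteq> {}" using bsum \<open>0 < \<tau>\<close> by (metis leD sum.empty)
    then obtain q where "q \<in> dom \<gamma>" "grid_adj q z"
      using grid_adj_commute unfolding nbs_def by blast
    then show ?thesis
      using grid_connected_insert st unfolding stable_assembly_def is_assembly_def by auto
  qed
  moreover have "tau_stable \<tau> ?\<delta>"
    unfolding tau_stable_def
  proof (intro allI impI)
    fix A assume A: "A \<subseteq> dom ?\<delta> \<and> A \<noteq> {} \<and> A \<noteq> dom ?\<delta>"
    have cut: "\<exists>F. finite F \<and> F \<subseteq> {(p, q). p \<in> A \<and> q \<in> dom ?\<delta> - A} \<and> \<tau> \<le> (\<Sum>(p, q)\<in>F. bond ?\<delta> p q)"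
      if B: "B \<subseteq> dom \<gamma>" "B \<noteq> {}" "B \<noteq> dom \<gamma>" and AB: "B \<subseteq> A" "dom \<gamma> - B \<subseteq> dom ?\<delta> - A" for B
    proof -
      obtain F where F: "finite F" "F \<subseteq> {(p, q). p \<in> B \<and> q \<in> dom \<gamma> - B}"
        "\<tau> \<le> (\<Sum>(p, q)\<in>F. bond \<gamma> p q)"
        using st B unfolding stable_assembly_def tau_stable_def by meson
      have "(\<Sum>(p, q)\<in>F. bond \<gamma> p q) = (\<Sum>(p, q)\<in>F. bond ?\<delta> p q)"
      proof (intro sum.cong refl)
        fix e assume "e \<in> F"
        then have "fst e \<in> dom \<gamma>" "snd e \<in> dom \<gamma>" using F(2) B(1) by force+
        then have "fst e \<noteq> z" "snd e \<noteq> z" using z by metis+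
        then show "(case e of (p, q) \<Rightarrow> bond \<gamma> p q) = (case e of (p, q) \<Rightarrow> bond ?\<delta> p q)"
          by (simp add: case_prod_beta bond_cong[of \<gamma> _ ?\<delta>])
      qed
      moreover have "F \<subseteq> {(p, q). p \<in> A \<and> q \<in> dom ?\<delta> - A}"
        using F(2) AB by blast
      ultimately show ?thesis using F by (intro exI[of _ F]) simp
    qed
    \<comment> \<open>The first two cases are the two orientations of the cut isolating
      \<open>z\<close>; the other two reduce to \<open>cut\<close>.\<close>
    consider "A = {z}" | "A = dom \<gamma>" | "z \<in> A" "A \<noteq> {z}" | "z \<notin> A" "A \<noteq> dom \<gamma>" by blast
    then show "\<exists>F. finite F \<and> F \<subseteq> {(p, q). p \<in> A \<and> q \<in> dom ?\<delta> - A} \<and> \<tau> \<le> (\<Sum>(p, q)\<in>F. bond ?\<delta> p q)"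
    proof cases
      case 1
      have "(\<Sum>(p, q)\<in>Pair z ` (nbs z \<inter> dom \<gamma>). bond ?\<delta> p q) = (\<Sum>q\<in>nbs z \<inter> dom \<gamma>. bond ?\<delta> z q)"
        by (subst sum.reindex) (auto simp: inj_on_def)
      then show ?thesis
        using bsum 1 z by (intro exI[of _ "Pair z ` (nbs z \<inter> dom \<gamma>)"]) auto
    next
      case 2
      have "(\<Sum>(p, q)\<in>(\<lambda>p. (p, z)) ` (nbs z \<inter> dom \<gamma>). bond ?\<delta> p q) = (\<Sum>q\<in>nbs z \<inter> dom \<gamma>. bond ?\<delta> z q)"
        by (subst sum.reindex) (auto simp: inj_on_def bond_commute intro!: sum.cong)
      then show ?thesis
        using bsum 2 z by (intro exI[of _ "(\<lambda>p. (p, z)) ` (nbs z \<inter> dom \<gamma>)"]) auto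
    next
      case 3
      have "A - {z} \<noteq> dom \<gamma>" using A 3 by auto
      then show ?thesis using A 3 z by (intro cut[of "A - {z}"]) auto
    next
      case 4
      then show ?thesis using A z by (intro cut[of A]) auto
    qed
  qed
  ultimately show ?thesis unfolding stable_assembly_def by simp
qed

lemma stable_binding:
  assumes st: "stable_assembly T \<tau> \<gamma>" and z: "z \<in> dom \<gamma>" and "dom \<gamma> \<noteq> {z}"
  shows "\<tau> \<le> binding \<gamma> z"
proof -
  have "{z} \<subseteq> dom \<gamma> \<and> {z} \<noteq> {} \<and> {z} \<noteq> dom \<gamma>" using z assms(3) by auto
  then obtain F where F: "finite F" "F \<subseteq> {(p, q). p \<in> {z} \<and> q \<in> dom \<gamma> - {z}}"
    "\<tau> \<le> (\<Sum>(p, q)\<in>F. bond \<gamma> p q)"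
    using st unfolding stable_assembly_def tau_stable_def by meson
  have eq: "F = Pair z ` (snd ` F)" using F(2) by force
  have "(\<Sum>(p, q)\<in>F. bond \<gamma> p q) = (\<Sum>q\<in>snd ` F. bond \<gamma> z q)"
    by (subst eq, subst sum.reindex) (auto simp: inj_on_def)
  also have "\<dots> = (\<Sum>q\<in>snd ` F \<inter> nbs z. bond \<gamma> z q)"
    using F(1) by (intro sum.mono_neutral_right) (simp_all add: bond_not_adj)
  also have "\<dots> \<le> binding \<gamma> z"
    unfolding binding_def by (intro sum_mono2) auto
  finally show ?thesis using F(3) by simp
qed

lemma step1_obtain:
  assumes "step1 T \<tau> \<alpha> \<beta>"
  obtains z t where "z \<notin> dom \<alpha>" "t \<in> T" "\<beta> = \<alpha>(z \<mapsto> t)" "\<tau> \<le> binding \<beta> z"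
proof -
  have st: "stable_assembly T \<tau> \<alpha>" "stable_assembly T \<tau> \<beta>" and sub: "\<alpha> \<subseteq>\<^sub>m \<beta>"
    and "card (dom \<beta> - dom \<alpha>) = 1"
    using assms unfolding step1_def by auto
  then obtain z where z: "dom \<beta> - dom \<alpha> = {z}" by (meson card_1_singletonE)
  then obtain t where t: "\<beta> z = Some t" "z \<notin> dom \<alpha>" by blast
  have "\<beta> x = (\<alpha>(z \<mapsto> t)) x" for x
  proof (cases "x = z \<or> x \<in> dom \<alpha>")
    case True
    moreover have "x \<in> dom \<alpha> \<Longrightarrow> \<alpha> x = \<beta> x" using sub unfolding map_le_def by blast
    ultimately show ?thesis using t(1) by (cases "x = z") auto
  next
    case False
    then have "x \<notin> dom \<beta>" using z by blast
    then have "\<beta> x = None" by blast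
    moreover have "\<alpha> x = None" using False by blast
    ultimately show ?thesis using False by simp
  qed
  then have "\<beta> = \<alpha>(z \<mapsto> t)" by blast
  moreover have "t \<in> T" using st(2) t(1) unfolding stable_assembly_def by (auto intro: ranI)
  moreover have "dom \<alpha> \<noteq> {}" using st(1) unfolding stable_assembly_def is_assembly_def by simp
  then have "dom \<beta> \<noteq> {z}" "z \<in> dom \<beta>" using map_le_implies_dom_le[OF sub] z by blast+
  then have "\<tau> \<le> binding \<beta> z" using stable_binding[OF st(2)] by simp
  ultimately show ?thesis using that t by blast
qed

lemma step1_attach:
  assumes "stable_assembly T \<tau> \<alpha>" "z \<notin> dom \<alpha>" "stable_assembly T \<tau> (\<alpha>(z \<mapsto> t))"
  shows "step1 T \<tau> \<alpha> (\<alpha>(z \<mapsto> t))"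
proof -
  have "dom (\<alpha>(z \<mapsto> t)) - dom \<alpha> = {z}" using assms by auto
  then show ?thesis using assms unfolding step1_def by (auto simp: map_le_def)
qed

section \<open>Assembly sequences and their limits\<close>

lemma chain_mono:
  assumes "\<And>i. f i \<subseteq>\<^sub>m f (Suc i)" "i \<le> j" shows "f i \<subseteq>\<^sub>m f j"
  using assms(2) by (induction j rule: dec_induct) (auto intro: map_le_trans assms(1))

text \<open>The limit reads a position at an arbitrarily chosen stage where it is filled; since the
  stages extend one another, the choice does not matter.\<close>

lemma seq_result_eq:
  assumes "\<And>i. f i \<subseteq>\<^sub>m f (Suc i)" "f i x = Some t"
  shows "seq_result f x = Some t"
proof -
  let ?j = "SOME j. f j x \<noteq> None"
  have "f ?j x \<noteq> None" by (rule someI[of _ i]) (simp add: assms)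
  then obtain u where u: "f ?j x = Some u" by blast
  have le: "f i \<subseteq>\<^sub>m f (max i ?j)" "f ?j \<subseteq>\<^sub>m f (max i ?j)"
    by (rule chain_mono[of f, OF assms(1)], simp)+
  have "u = t" using map_leD[where f = "f ?j" and x = x, OF le(2) u] map_leD[where f = "f i" and x = x, OF le(1) assms(2)] by simp
  moreover have "\<exists>i. f i x \<noteq> None" using assms(2) by (intro exI[of _ i]) simp
  ultimately show ?thesis using u unfolding seq_result_def by simp
qed

lemma seq_result_upper: "(\<And>i. f i \<subseteq>\<^sub>m f (Suc i)) \<Longrightarrow> f i \<subseteq>\<^sub>m seq_result f"
  by (rule map_leI) (rule seq_result_eq)

lemma dom_seq_result: "dom (seq_result f) = (\<Union>i. dom (f i))"
proof -
  have "seq_result f x \<noteq> None \<longleftrightarrow> (\<exists>i. f i x \<noteq> None)" for x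
    unfolding seq_result_def using someI_ex[of "\<lambda>i. f i x \<noteq> None"] by simp
  then show ?thesis unfolding dom_def by blast
qed

lemma finite_in_chain:
  assumes "\<And>i. f i \<subseteq>\<^sub>m f (Suc i)" "finite A" "A \<subseteq> (\<Union>i. dom (f i))"
  shows "\<exists>i. A \<subseteq> dom (f i)"
  using assms(2,3)
proof (induction A)
  case (insert a A)
  then obtain i j where "A \<subseteq> dom (f i)" "a \<in> dom (f j)" by blast
  moreover have "dom (f i) \<subseteq> dom (f (max i j))" "dom (f j) \<subseteq> dom (f (max i j))"
    by (rule map_le_implies_dom_le, rule chain_mono[of f, OF assms(1)], simp)+
  ultimately show ?case by (intro exI[of _ "max i j"]) blast
qed simp

text \<open>A cut of the limit has a point on either side; a stage containing both is cut properly
  too, and the finitely many edges found there also serve in the limit. Connectedness is inherited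
  in the same way.\<close>

lemma stable_seq_result:
  assumes mono: "\<And>i. f i \<subseteq>\<^sub>m f (Suc i)" and st: "\<And>i. stable_assembly T \<tau> (f i)"
  shows "stable_assembly T \<tau> (seq_result f)"
proof -
  let ?L = "seq_result f"
  have domL: "dom ?L = (\<Union>i. dom (f i))" by (rule dom_seq_result)
  have le: "f i \<subseteq>\<^sub>m ?L" for i by (rule seq_result_upper, rule mono)
  have fin: "\<exists>i. B \<subseteq> dom (f i)" if "finite B" "B \<subseteq> (\<Union>i. dom (f i))" for B
    by (rule finite_in_chain[where f = f]) (rule mono that)+
  have "ran ?L \<subseteq> T"
  proof
    fix t assume "t \<in> ran ?L"
    then obtain x where x: "?L x = Some t" unfolding ran_def by auto
    then have "x \<in> dom ?L" by blast
    then obtain i u where u: "f i x = Some u" unfolding domL by blast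
    then have "f i x = Some t" using map_leD[OF le u] x by simp
    then show "t \<in> T" using st[of i] unfolding stable_assembly_def by (blast intro: ranI)
  qed
  moreover have "is_assembly ?L"
    unfolding is_assembly_def grid_connected_def
  proof (intro conjI ballI)
    show "dom ?L \<noteq> {}"
      using stable_assemblyD(2)[OF st[of 0]] map_le_implies_dom_le[OF le[of 0]] by (metis subset_empty)
    fix p q assume "p \<in> dom ?L" "q \<in> dom ?L"
    then have "{p, q} \<subseteq> (\<Union>i. dom (f i))" unfolding domL by blast
    then obtain i where i: "{p, q} \<subseteq> dom (f i)"
      using fin[of "{p, q}"] by (metis finite.simps)
    then have pq: "(p, q) \<in> (grid_edges (dom (f i)))\<^sup>*"
      using stable_assemblyD(3)[OF st[of i]] unfolding grid_connected_def by (meson insert_subset)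
    have "grid_edges (dom (f i)) \<subseteq> grid_edges (dom ?L)"
      using map_le_implies_dom_le[OF le[of i]] unfolding grid_edges_def
      by (intro Collect_mono) (auto simp del: domIff)
    from rtrancl_mono[OF this] pq show "(p, q) \<in> (grid_edges (dom ?L))\<^sup>*" by (rule subsetD)
  qed
  moreover have "tau_stable \<tau> ?L"
    unfolding tau_stable_def
  proof (intro allI impI)
    fix A assume A: "A \<subseteq> dom ?L \<and> A \<noteq> {} \<and> A \<noteq> dom ?L"
    then obtain a b where ab: "a \<in> A" "b \<in> dom ?L - A" by blast
    then have "{a, b} \<subseteq> (\<Union>i. dom (f i))" using A unfolding domL by blast
    then obtain i where i: "{a, b} \<subseteq> dom (f i)"
      using fin[of "{a, b}"] by (metis finite.simps)
    have "A \<inter> dom (f i) \<subseteq> dom (f i) \<and> A \<inter> dom (f i) \<noteq> {} \<and> A \<inter> dom (f i) \<noteq> dom (f i)"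
      using i ab by (auto simp del: dom_eq_empty_conv)
    then obtain F where F: "finite F" "F \<subseteq> {(p, q). p \<in> A \<inter> dom (f i) \<and> q \<in> dom (f i) - A \<inter> dom (f i)}"
        "\<tau> \<le> (\<Sum>(p, q)\<in>F. bond (f i) p q)"
      using st[of i] unfolding stable_assembly_def tau_stable_def by meson
    have "(\<Sum>(p, q)\<in>F. bond (f i) p q) = (\<Sum>(p, q)\<in>F. bond ?L p q)"
    proof (intro sum.cong refl)
      fix e assume "e \<in> F"
      then have "fst e \<in> dom (f i)" "snd e \<in> dom (f i)" using F(2) by force+
      then have "f i (fst e) = ?L (fst e)" "f i (snd e) = ?L (snd e)"
        using le[of i] unfolding map_le_def by blast+
      then show "(case e of (p, q) \<Rightarrow> bond (f i) p q) = (case e of (p, q) \<Rightarrow> bond ?L p q)"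
        by (simp add: case_prod_beta bond_cong[of "f i" _ ?L])
    qed
    moreover have "F \<subseteq> {(p, q). p \<in> A \<and> q \<in> dom ?L - A}"
      using F(2) map_le_implies_dom_le[OF le[of i]] by blast
    ultimately show "\<exists>F. finite F \<and> F \<subseteq> {(p, q). p \<in> A \<and> q \<in> dom ?L - A} \<and> \<tau> \<le> (\<Sum>(p, q)\<in>F. bond ?L p q)"
      using F by (intro exI[of _ F]) simp
  qed
  ultimately show ?thesis unfolding stable_assembly_def by simp
qed

section \<open>Reachable assemblies and fair growth in a fixed tile system\<close>

locale tile_system =
  fixes T :: "'l tile set" and \<sigma> :: "'l config" and \<tau> :: nat
  assumes TAS: "is_TAS T \<sigma> \<tau>"
begin

lemma tau_pos: "0 < \<tau>" and finite_seed: "finite (dom \<sigma>)" and stable_seed: "stable_assembly T \<tau> \<sigma>"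
  and finite_tiles: "finite T"
  using TAS unfolding is_TAS_def by auto

definition reach :: "'l config \<Rightarrow> bool" where
  "reach = (step1 T \<tau>)\<^sup>*\<^sup>* \<sigma>"

lemma reach_stable: "reach \<gamma> \<Longrightarrow> stable_assembly T \<tau> \<gamma>"
  unfolding reach_def by (induction rule: rtranclp_induct) (auto simp: stable_seed step1_def)

lemma reach_finite: "reach \<gamma> \<Longrightarrow> finite (dom \<gamma>)"
  unfolding reach_def
proof (induction rule: rtranclp_induct)
  case (step y z)
  then obtain w t where "z = y(w \<mapsto> t)" by (elim step1_obtain)
  then show ?case using step.IH by (simp only: dom_fun_upd) simp
qed (rule finite_seed)

lemma reach_seed: "reach \<gamma> \<Longrightarrow> \<sigma> \<subseteq>\<^sub>m \<gamma>"
  unfolding reach_def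
  by (induction rule: rtranclp_induct) (auto simp: step1_def intro: map_le_trans)

lemma reach_step: "reach \<gamma> \<Longrightarrow> step1 T \<tau> \<gamma> \<delta> \<Longrightarrow> reach \<delta>"
  unfolding reach_def by auto

lemma reach_attach:
  assumes "reach \<gamma>" "z \<notin> dom \<gamma>" "t \<in> T" "\<tau> \<le> binding (\<gamma>(z \<mapsto> t)) z"
  shows "reach (\<gamma>(z \<mapsto> t))"
  using assms by (meson reach_step reach_stable step1_attach stable_attach tau_pos)

definition frontier :: "'l config \<Rightarrow> (int \<times> int) set" where
  "frontier \<gamma> = {z. z \<notin> dom \<gamma> \<and> (\<exists>t\<in>T. stable_assembly T \<tau> (\<gamma>(z \<mapsto> t)))}"

definition index :: "int \<times> int \<Rightarrow> nat" where
  "index z = prod_encode (int_encode (fst z), int_encode (snd z))"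

lemma inj_index: "inj index"
  unfolding index_def inj_on_def by (auto simp: prod_eq_iff int_encode_eq)

text \<open>Always serving the attachable position of least index makes the growth fair. The value
  is meaningful only if the frontier is nonempty.\<close>

definition site :: "'l config \<Rightarrow> int \<times> int" where
  "site \<gamma> = (ARG_MIN index z. z \<in> frontier \<gamma>)"

definition fair_step :: "'l config \<Rightarrow> 'l config" where
  "fair_step \<gamma> = \<gamma>(site \<gamma> \<mapsto> (SOME t. t \<in> T \<and> stable_assembly T \<tau> (\<gamma>(site \<gamma> \<mapsto> t))))"

lemma site:
  assumes "z \<in> frontier \<gamma>"
  shows "site \<gamma> \<in> frontier \<gamma>" "index (site \<gamma>) \<le> index z"
  using arg_min_nat_lemma[of "\<lambda>z. z \<in> frontier \<gamma>" z index] assms unfolding site_def by auto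

lemma fair_step:
  assumes "stable_assembly T \<tau> \<gamma>" "frontier \<gamma> \<noteq> {}"
  shows "step1 T \<tau> \<gamma> (fair_step \<gamma>)"
proof -
  have "site \<gamma> \<in> frontier \<gamma>" using assms(2) site by blast
  then have "\<exists>t. t \<in> T \<and> stable_assembly T \<tau> (\<gamma>(site \<gamma> \<mapsto> t))" "site \<gamma> \<notin> dom \<gamma>"
    unfolding frontier_def by auto
  then show ?thesis
    unfolding fair_step_def using someI_ex step1_attach assms(1) by (metis (mono_tags, lifting))
qed

lemma terminal_iff: "terminal T \<tau> \<gamma> \<longleftrightarrow> stable_assembly T \<tau> \<gamma> \<and> frontier \<gamma> = {}"
  unfolding terminal_def frontier_def by auto

text \<open>Suppose \<open>z\<close> could still be attached to the limit. Its finitely many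
  neighbours are settled from some stage on, so from then on \<open>z\<close> stays in the frontier
  and every site served has index at most \<open>index z\<close>. But the sites are pairwise
  distinct and infinitely many.\<close>

lemma fair_limit_terminal:
  assumes st: "stable_assembly T \<tau> \<gamma>" and ne: "\<And>i. frontier ((fair_step ^^ i) \<gamma>) \<noteq> {}"
  shows "(\<forall>i. step1 T \<tau> ((fair_step ^^ i) \<gamma>) ((fair_step ^^ Suc i) \<gamma>)) \<and>
         terminal T \<tau> (seq_result (\<lambda>i. (fair_step ^^ i) \<gamma>))"
proof -
  define g where "g i = (fair_step ^^ i) \<gamma>" for i
  have stg: "stable_assembly T \<tau> (g i)" for i
    unfolding g_def
  proof (induction i)
    case (Suc i)
    then show ?case using fair_step[OF Suc ne] unfolding step1_def by simp
  qed (simp add: st)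
  have step: "step1 T \<tau> (g i) (g (Suc i))" for i
    using fair_step[OF stg[of i]] ne unfolding g_def by simp
  then have mono: "g i \<subseteq>\<^sub>m g (Suc i)" for i unfolding step1_def by simp
  define L where "L = seq_result g"
  have stL: "stable_assembly T \<tau> L"
    unfolding L_def by (rule stable_seq_result, rule mono, rule stg)
  have le: "g i \<subseteq>\<^sub>m L" for i unfolding L_def by (rule seq_result_upper, rule mono)
  have domL: "dom L = (\<Union>i. dom (g i))" unfolding L_def by (rule dom_seq_result)
  have "frontier L = {}"
  proof (rule ccontr)
    assume "frontier L \<noteq> {}"
    then obtain z t where z: "z \<notin> dom L" "t \<in> T" "stable_assembly T \<tau> (L(z \<mapsto> t))"
      unfolding frontier_def by blast
    have b: "\<tau> \<le> binding (L(z \<mapsto> t)) z"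
    proof (rule stable_binding[OF z(3)])
      show "dom (L(z \<mapsto> t)) \<noteq> {z}" using z(1) stable_assemblyD(2)[OF stL] by auto
    qed simp
    have "\<exists>i. nbs z \<inter> dom L \<subseteq> dom (g i)"
    proof (rule finite_in_chain[where f = g])
      show "nbs z \<inter> dom L \<subseteq> (\<Union>i. dom (g i))" unfolding domL by (rule Int_lower2)
    qed (simp_all only: mono finite_Int finite_nbs simp_thms)
    then obtain i0 where i0: "nbs z \<inter> dom L \<subseteq> dom (g i0)" by blast
    have "z \<in> frontier (g i)" if "i0 \<le> i" for i
    proof -
      have zi: "z \<notin> dom (g i)" by (rule contra_subsetD[OF map_le_implies_dom_le[OF le] z(1)])
      have "bond ((g i)(z \<mapsto> t)) z q = bond (L(z \<mapsto> t)) z q" if "q \<in> nbs z" for q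
      proof -
        have "q \<noteq> z" using that by (cases z) (auto simp: nbs_eq)
        moreover have "g i q = L q"
        proof (cases "q \<in> dom L")
          case True
          have "g i0 \<subseteq>\<^sub>m g i" by (rule chain_mono[of g, OF mono \<open>i0 \<le> i\<close>])
          then have "q \<in> dom (g i)"
            by (rule subsetD[OF map_le_implies_dom_le subsetD[OF i0 IntI[OF that True]]])
          then show ?thesis using le[of i, unfolded map_le_def] by (rule bspec[rotated])
        next
          case False
          then have "q \<notin> dom (g i)" by (rule contra_subsetD[OF map_le_implies_dom_le[OF le]])
          then show ?thesis using False by (simp add: domIff)
        qed
        ultimately show ?thesis by (intro bond_cong) simp_all
      qed
      then have "binding ((g i)(z \<mapsto> t)) z = binding (L(z \<mapsto> t)) z"
        unfolding binding_def by (rule sum.cong[OF refl])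
      then have "stable_assembly T \<tau> ((g i)(z \<mapsto> t))"
        using b by (intro stable_attach[OF stg zi z(2) tau_pos]) simp
      then show ?thesis
        using z(2) zi unfolding frontier_def mem_Collect_eq by (intro conjI bexI)
    qed
    then have idx: "index (site (g i)) \<le> index z" if "i0 \<le> i" for i using site(2) that by blast
    have new: "site (g i) \<in> dom (g (Suc i)) - dom (g i)" for i
    proof -
      have "g (Suc i) = fair_step (g i)" unfolding g_def by simp
      then have "site (g i) \<in> dom (g (Suc i))" unfolding fair_step_def by simp
      moreover have "site (g i) \<in> frontier (g i)"
        using site(1) ne[of i] unfolding g_def by (metis all_not_in_conv)
      ultimately show ?thesis unfolding frontier_def by simp
    qed
    have inj: "inj_on (\<lambda>i. index (site (g i))) {i0..}"
    proof (rule linorder_inj_onI)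
      fix i j :: nat assume "i < j"
      then have "dom (g (Suc i)) \<subseteq> dom (g j)"
        by (intro map_le_implies_dom_le chain_mono[of g, OF mono]) simp
      then have i: "site (g i) \<in> dom (g j)" by (rule subsetD[OF _ DiffD1[OF new]])
      have j: "site (g j) \<notin> dom (g j)" using new[of j] by (simp only: Diff_iff simp_thms)
      have "site (g i) \<noteq> site (g j)"
      proof
        assume eq: "site (g i) = site (g j)"
        show False using j i unfolding eq by contradiction
      qed
      then show "index (site (g i)) \<noteq> index (site (g j))" using inj_index by (auto dest: injD)
    qed auto
    have fin: "finite ((\<lambda>i. index (site (g i))) ` {i0..})"
      by (rule finite_subset[of _ "{..index z}"]) (use idx in \<open>simp_all add: image_subset_iff\<close>)
    have "finite {i0..}" by (rule finite_imageD[OF fin inj])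
    then show False using infinite_Ici by contradiction
  qed
  then have "terminal T \<tau> L" using stL terminal_iff by simp
  moreover have "L = seq_result (\<lambda>i. (fair_step ^^ i) \<gamma>)"
    unfolding L_def by (rule arg_cong[where f = seq_result]) (auto simp: g_def)
  ultimately show ?thesis using step unfolding g_def by auto
qed

lemma reach_sequence:
  assumes "reach \<gamma>"
  obtains n f where "f 0 = \<sigma>" "f n = \<gamma>" "\<And>i. i < n \<Longrightarrow> step1 T \<tau> (f i) (f (Suc i))"
  using assms unfolding reach_def by (metis rtranclp_imp_relpowp relpowp_fun_conv)

text \<open>This carries the hypothesis on terminal assemblies over to all reachable ones. The final
  disjunction provides, for an infinite shape, an infinite history from which movies can be read
  off.\<close>

lemma terminal_extension:
  assumes "reach \<gamma>"
  shows "\<exists>\<alpha>. producible T \<sigma> \<tau> \<alpha> \<and> terminal T \<tau> \<alpha> \<and> \<gamma> \<subseteq>\<^sub>m \<alpha> \<and>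
    (finite (dom \<alpha>) \<or> (\<exists>f. f 0 = \<sigma> \<and> (\<forall>i. step1 T \<tau> (f i) (f (Suc i))) \<and> \<alpha> = seq_result f))"
proof -
  define g where "g i = (fair_step ^^ i) \<gamma>" for i
  show ?thesis
  proof (cases "\<exists>i. frontier (g i) = {}")
    case True
    define m where "m = (LEAST i. frontier (g i) = {})"
    have m: "frontier (g m) = {}" and least: "\<And>i. i < m \<Longrightarrow> frontier (g i) \<noteq> {}"
      unfolding m_def using True LeastI_ex not_less_Least by (metis (mono_tags, lifting))+
    have "reach (g i) \<and> \<gamma> \<subseteq>\<^sub>m g i" if "i \<le> m" for i
      using that
    proof (induction i)
      case 0
      then show ?case using assms by (simp add: g_def)
    next
      case (Suc i)
      then have "step1 T \<tau> (g i) (g (Suc i))"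
        using fair_step[of "g i"] least reach_stable by (simp add: g_def)
      then show ?case using Suc reach_step unfolding step1_def by (auto intro: map_le_trans)
    qed
    then have r: "reach (g m)" "\<gamma> \<subseteq>\<^sub>m g m" by auto
    obtain n f where "f 0 = \<sigma>" "f n = g m" "\<And>i. i < n \<Longrightarrow> step1 T \<tau> (f i) (f (Suc i))"
      using reach_sequence[OF r(1)] by blast
    then have "producible T \<sigma> \<tau> (g m)" unfolding producible_def by metis
    then show ?thesis using r m reach_stable reach_finite terminal_iff by blast
  next
    case False
    then have lim: "\<And>i. step1 T \<tau> (g i) (g (Suc i))" "terminal T \<tau> (seq_result g)"
      using fair_limit_terminal[OF reach_stable[OF assms]] unfolding g_def by auto
    obtain n f where f: "f 0 = \<sigma>" "f n = \<gamma>" "\<And>i. i < n \<Longrightarrow> step1 T \<tau> (f i) (f (Suc i))"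
      using reach_sequence[OF assms] by blast
    \<comment> \<open>The finite history of \<gamma> followed by its fair continuation. The two
      limits agree because \<open>h i\<close> lies below \<open>g i\<close>, which is a later stage
      of \<open>h\<close>.\<close>
    define h where "h i = (if i \<le> n then f i else g (i - n))" for i
    have h0: "h 0 = \<sigma>" using f by (simp add: h_def)
    have hn: "h (n + i) = g i" for i using f by (auto simp: h_def g_def)
    have step: "step1 T \<tau> (h i) (h (Suc i))" for i
    proof (cases "i < n")
      case True
      then show ?thesis using f by (simp add: h_def)
    next
      case False
      then show ?thesis using lim(1)[of "i - n"] hn[of "i - n"] hn[of "Suc (i - n)"] by simp
    qed
    have hm: "h i \<subseteq>\<^sub>m h (Suc i)" and gm: "g i \<subseteq>\<^sub>m g (Suc i)" for i
      using step[of i] lim(1)[of i] unfolding step1_def by simp_all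
    have "seq_result h x = seq_result g x" for x
    proof (cases "x \<in> dom (seq_result g)")
      case True
      then obtain i u where u: "g i x = Some u" unfolding dom_seq_result by blast
      have "seq_result h x = Some u"
        by (rule seq_result_eq[where f = h and i = "n + i"]) (simp_all add: hm hn u)
      moreover have "seq_result g x = Some u"
        by (rule seq_result_eq[where f = g and i = i]) (simp_all add: gm u)
      ultimately show ?thesis by simp
    next
      case False
      have "h i \<subseteq>\<^sub>m g i" for i
        using chain_mono[where f = h and i = i and j = "n + i", OF hm] hn[of i] by simp
      then have "dom (seq_result h) \<subseteq> dom (seq_result g)"
        unfolding dom_seq_result by (intro UN_mono map_le_implies_dom_le) simp_all
      then have "x \<notin> dom (seq_result h)" using False by (rule contra_subsetD)
      then show ?thesis using False by (simp add: domIff)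
    qed
    then have "seq_result h = seq_result g" by (rule ext)
    moreover have "\<gamma> \<subseteq>\<^sub>m seq_result g"
      using seq_result_upper[where f = g and i = 0, OF gm] by (simp add: g_def)
    moreover have "producible T \<sigma> \<tau> (seq_result h)"
      unfolding producible_def using h0 step by (intro disjI2 exI[of _ h]) simp
    ultimately show ?thesis using lim(2) h0 step by (intro exI[of _ "seq_result g"]) auto
  qed
qed

text \<open>Every dependency of a site precedes it in a well-founded order, so each site can be
  filled after recursively filling the sites it depends on.\<close>
lemma reach_by_rank:
  fixes rank :: "int \<times> int \<Rightarrow> nat \<times> nat"
  assumes seed: "\<sigma> \<subseteq>\<^sub>m \<beta>" and tiles: "ran \<beta> \<subseteq> T"
    and bind: "\<And>x. x \<in> dom \<beta> - dom \<sigma> \<Longrightarrow>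
      \<tau> \<le> (\<Sum>z | z \<in> nbs x \<and> z \<in> dom \<beta> \<and> (rank z, rank x) \<in> less_than <*lex*> less_than. bond \<beta> x z)"
    and "x \<in> dom \<beta>"
  shows "\<exists>\<gamma>. reach \<gamma> \<and> x \<in> dom \<gamma>"
proof -
  let ?R = "inv_image (less_than <*lex*> less_than) rank"
  have wf: "wf ?R" by (intro wf_inv_image wf_lex_prod wf_less_than)
  \<comment> \<open>Stated for every reachable start below \<beta>, not only for the seed, so that
    the dependencies of a site can be filled one after another within one growing assembly.\<close>
  have ext: "\<exists>\<delta>. reach \<delta> \<and> \<gamma> \<subseteq>\<^sub>m \<delta> \<and> \<delta> \<subseteq>\<^sub>m \<beta> \<and> x \<in> dom \<delta>"
    if "x \<in> dom \<beta>" "reach \<gamma>" "\<gamma> \<subseteq>\<^sub>m \<beta>" for x \<gamma>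
    using wf that
  proof (induction x arbitrary: \<gamma> rule: wf_induct_rule)
    case (less x)
    show ?case
    proof (cases "x \<in> dom \<gamma>")
      case True
      then show ?thesis using less.prems by (intro exI[of _ \<gamma>]) simp
    next
      case False
      define D where "D = {z. z \<in> nbs x \<and> z \<in> dom \<beta> \<and> (rank z, rank x) \<in> less_than <*lex*> less_than}"
      have "finite D" unfolding D_def by (rule finite_subset[OF _ finite_nbs[of x]]) auto
      have "\<exists>\<delta>. reach \<delta> \<and> \<gamma> \<subseteq>\<^sub>m \<delta> \<and> \<delta> \<subseteq>\<^sub>m \<beta> \<and> D' \<subseteq> dom \<delta>" if "D' \<subseteq> D" for D'
        using finite_subset[OF that \<open>finite D\<close>] that
      proof (induction D')
        case empty
        then show ?case using less.prems by (intro exI[of _ \<gamma>]) simp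
      next
        case (insert z D')
        then obtain \<delta> where \<delta>: "reach \<delta>" "\<gamma> \<subseteq>\<^sub>m \<delta>" "\<delta> \<subseteq>\<^sub>m \<beta>" "D' \<subseteq> dom \<delta>" by auto
        have "(z, x) \<in> ?R" "z \<in> dom \<beta>" using insert.prems unfolding D_def by auto
        then obtain \<epsilon> where \<epsilon>: "reach \<epsilon>" "\<delta> \<subseteq>\<^sub>m \<epsilon>" "\<epsilon> \<subseteq>\<^sub>m \<beta>" "z \<in> dom \<epsilon>"
          using less.IH[of z \<delta>] \<delta>(1,3) by metis
        have "\<gamma> \<subseteq>\<^sub>m \<epsilon>" using \<delta>(2) \<epsilon>(2) by (rule map_le_trans)
        moreover have "insert z D' \<subseteq> dom \<epsilon>"
          using \<delta>(4) \<epsilon>(4) map_le_implies_dom_le[OF \<epsilon>(2)] by simp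
        ultimately show ?case using \<epsilon>(1,3) by (intro exI[of _ \<epsilon>]) simp
      qed
      then obtain \<delta> where \<delta>: "reach \<delta>" "\<gamma> \<subseteq>\<^sub>m \<delta>" "\<delta> \<subseteq>\<^sub>m \<beta>" "D \<subseteq> dom \<delta>" by blast
      show ?thesis
      proof (cases "x \<in> dom \<delta>")
        case True
        then show ?thesis using \<delta>(1-3) by (intro exI[of _ \<delta>]) simp
      next
        case out: False
        obtain t where t: "\<beta> x = Some t" using less.prems(1) by blast
        let ?\<epsilon> = "\<delta>(x \<mapsto> t)"
        have eq: "?\<epsilon> z = \<beta> z" if "z \<in> insert x D" for z
        proof (cases "z = x")
          case True
          then show ?thesis using t by simp
        next
          case False
          then have "z \<in> dom \<delta>" using that \<delta>(4) by blast
          then show ?thesis using False \<delta>(3) unfolding map_le_def by simp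
        qed
        have "x \<notin> dom \<sigma>" by (rule contra_subsetD[OF map_le_implies_dom_le[OF reach_seed[OF less.prems(2)]] False])
        then have "\<tau> \<le> (\<Sum>z\<in>D. bond \<beta> x z)" unfolding D_def using bind less.prems by simp
        also have "\<dots> = (\<Sum>z\<in>D. bond ?\<epsilon> x z)"
        proof (rule sum.cong[OF refl])
          fix z assume "z \<in> D"
          then have "?\<epsilon> x = \<beta> x" "?\<epsilon> z = \<beta> z" using eq by blast+
          then show "bond \<beta> x z = bond ?\<epsilon> x z" by (metis bond_cong)
        qed
        also have "\<dots> \<le> binding ?\<epsilon> x"
          unfolding binding_def by (intro sum_mono2) (auto simp: D_def)
        finally have "\<tau> \<le> binding ?\<epsilon> x" .
        moreover have "t \<in> T" using tiles t by (metis ranI subsetD)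
        ultimately have "reach ?\<epsilon>" using reach_attach[OF \<delta>(1) out] by simp
        moreover have "\<delta> \<subseteq>\<^sub>m ?\<epsilon>"
        proof (rule map_leI)
          fix y v assume y: "\<delta> y = Some v"
          then have "y \<noteq> x" using out by (metis domI)
          then show "?\<epsilon> y = Some v" using y by simp
        qed
        then have "\<gamma> \<subseteq>\<^sub>m ?\<epsilon>" by (rule map_le_trans[OF \<delta>(2)])
        moreover have "?\<epsilon> \<subseteq>\<^sub>m \<beta>"
        proof (rule map_leI)
          fix y v assume "?\<epsilon> y = Some v"
          then show "\<beta> y = Some v" using t map_leD[OF \<delta>(3)] by (cases "y = x") auto
        qed
        moreover have "x \<in> dom ?\<epsilon>" by simp
        ultimately show ?thesis by (intro exI conjI)
      qed
    qed
  qed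
  have "reach \<sigma>" unfolding reach_def by simp
  from ext[OF assms(4) this seed] show ?thesis by (elim exE conjE) (rule exI, rule conjI)
qed

end

section \<open>Self-similar fractals\<close>

lemma div_add_mult_power:
  fixes m n g k i :: nat
  assumes "k < i"
  shows "(m + g ^ i * n) div g ^ k mod g = m div g ^ k mod g"
proof (cases "g = 0")
  case False
  obtain d where "i = Suc (k + d)" using assms less_iff_Suc_add by auto
  then have "m + g ^ i * n = m + g ^ k * (g * (g ^ d * n))" by (simp add: power_add algebra_simps)
  moreover have "(m + g ^ k * (g * (g ^ d * n))) div g ^ k = g * (g ^ d * n) + m div g ^ k"
    using False by simp
  ultimately have "(m + g ^ i * n) div g ^ k = g * (g ^ d * n) + m div g ^ k" by argo
  then show ?thesis by simp
qed (use assms in \<open>simp add: power_0_left\<close>)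

lemma embZ_inj: "inj embZ"
  unfolding embZ_def inj_def by auto

lemma mem_embZ: "(int a, int b) \<in> embZ ` S \<longleftrightarrow> (a, b) \<in> S"
  unfolding embZ_def by force

section \<open>Base \<open>g\<close> digits and growth of a self-similar fractal\<close>

locale generator =
  fixes g :: nat and G :: "(nat \<times> nat) set"
  assumes g: "1 < g" and gen: "is_generator g G"
begin

definition fractal :: "(nat \<times> nat) set" where
  "fractal = (\<Union>i. dssf_stage g G i)"

lemma G_subset: "G \<subseteq> {0..<g} \<times> {0..<g}" and G_zero: "(0, 0) \<in> G"
  using gen unfolding is_generator_def by blast+

lemma G_bound: "(x, y) \<in> G \<Longrightarrow> x < g \<and> y < g"
  using G_subset by auto

lemma rows_columns: "y < g \<Longrightarrow> \<exists>x. (x, y) \<in> G" "x < g \<Longrightarrow> \<exists>y. (x, y) \<in> G"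
  using gen unfolding is_generator_def by blast+

lemma finite_G: "finite G"
  by (rule finite_subset[OF G_subset]) simp

lemma stage_bound: "(x, y) \<in> dssf_stage g G i \<Longrightarrow> x < g ^ Suc i \<and> y < g ^ Suc i"
proof (induction i arbitrary: x y)
  case 0
  then show ?case using G_bound by simp
next
  case (Suc i)
  then obtain a b m n where ab: "(a, b) \<in> dssf_stage g G i" "(m, n) \<in> G"
    and xy: "x = a + g ^ Suc i * m" "y = b + g ^ Suc i * n"
    unfolding dssf_stage.simps set_plus_scaled_def by auto
  have less: "c + g ^ Suc i * d < g ^ Suc (Suc i)" if "c < g ^ Suc i" "d < g" for c d
  proof -
    have "c + g ^ Suc i * d < g ^ Suc i * Suc d" using that by simp
    also have "\<dots> \<le> g ^ Suc i * g" using that by (intro mult_le_mono2) simp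
    finally show ?thesis by (simp add: mult.commute)
  qed
  show ?case using less Suc.IH[OF ab(1)] G_bound[OF ab(2)] xy by simp
qed

text \<open>Coordinates in a stage stay below \<open>g ^ Suc i\<close>, so division with remainder
  recovers both summands of a point of the next stage.\<close>

lemma card_stage: "card (dssf_stage g G i) = card G ^ Suc i \<and> finite (dssf_stage g G i)"
proof (induction i)
  case 0
  then show ?case using finite_G by simp
next
  case (Suc i)
  let ?S = "dssf_stage g G i"
  let ?f = "\<lambda>(m, n). (fst m + g ^ Suc i * fst n, snd m + g ^ Suc i * snd n) :: nat \<times> nat"
  have eq: "dssf_stage g G (Suc i) = ?f ` (?S \<times> G)"
    unfolding dssf_stage.simps set_plus_scaled_def by (auto simp: image_iff)
  have unique: "a = a' \<and> b = b'"
    if "a < K" "a' < K" "a + K * b = a' + K * b'" for a a' b b' K :: nat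
  proof -
    have "(a + K * b) mod K = a" "(a' + K * b') mod K = a'" using that(1,2) by simp_all
    then have "a = a'" using that(3) by metis
    then show ?thesis using that by auto
  qed
  have "inj_on ?f (?S \<times> G)"
  proof (rule inj_onI)
    fix p q assume pq: "p \<in> ?S \<times> G" "q \<in> ?S \<times> G" "?f p = ?f q"
    obtain a b m n where p: "p = ((a, b), (m, n))" by (metis prod.exhaust)
    obtain a' b' m' n' where q: "q = ((a', b'), (m', n'))" by (metis prod.exhaust)
    have "a < g ^ Suc i" "b < g ^ Suc i" "a' < g ^ Suc i" "b' < g ^ Suc i"
      using pq stage_bound unfolding p q by auto
    then show "p = q"
      using pq(3) unique[of a "g ^ Suc i" a' m m'] unique[of b "g ^ Suc i" b' n n'] unfolding p q
      by (simp del: power_Suc)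
  qed
  then show ?case unfolding eq using Suc finite_G by (simp add: card_image)
qed

text \<open>Each stage prefixes one base \<open>g\<close> digit pair taken from \<open>G\<close>;
  the leading zeros beyond it are covered by \<open>(0, 0)\<close> in \<open>G\<close>.\<close>

lemma stage_digits:
  "(x, y) \<in> dssf_stage g G i \<Longrightarrow> (x div g ^ k mod g, y div g ^ k mod g) \<in> G"
proof (induction i arbitrary: x y)
  case 0
  then have xy: "(x, y) \<in> G" "x < g" "y < g" using G_bound by auto
  show ?case
  proof (cases k)
    case (Suc j)
    have "g ^ 1 \<le> g ^ k" using g Suc by (intro power_increasing) auto
    then show ?thesis using xy G_zero by simp
  qed (use xy in simp)
next
  case (Suc i)
  note bound = stage_bound[OF Suc.prems]
  obtain a b m n where ab: "(a, b) \<in> dssf_stage g G i" "(m, n) \<in> G"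
    and xy: "x = a + g ^ Suc i * m" "y = b + g ^ Suc i * n"
    using Suc.prems unfolding dssf_stage.simps set_plus_scaled_def by auto
  consider "k < Suc i" | "k = Suc i" | "Suc (Suc i) \<le> k" by linarith
  then show ?case
  proof cases
    case 1
    then show ?thesis using Suc.IH[OF ab(1)] unfolding xy by (simp add: div_add_mult_power del: power_Suc)
  next
    case 2
    then show ?thesis
      using stage_bound[OF ab(1)] G_bound[OF ab(2)] ab(2) unfolding xy by (simp del: power_Suc)
  next
    case 3
    then have "g ^ Suc (Suc i) \<le> g ^ k" using g by (intro power_increasing) auto
    then show ?thesis using bound G_zero by simp
  qed
qed

lemma fractal_digits:
  assumes "(a, b) \<in> embZ ` fractal"
  shows "0 \<le> a \<and> 0 \<le> b \<and>
    (a div int g ^ k mod int g, b div int g ^ k mod int g) \<in> embZ ` G"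
proof -
  obtain x y where xy: "(x, y) \<in> fractal" "a = int x" "b = int y"
    using assms unfolding embZ_def by auto
  then have "embZ (x div g ^ k mod g, y div g ^ k mod g) \<in> embZ ` G"
    using stage_digits unfolding fractal_def by blast
  then show ?thesis unfolding xy by (simp add: embZ_def zdiv_int zmod_int)
qed

text \<open>If every row and column of the generator had just one point, the origin would be isolated.\<close>
lemma card_G:
  assumes "grid_connected (embZ ` fractal)"
  shows "g < card G"
proof (rule ccontr)
  assume small: "\<not> g < card G"
  have fst: "{0..<g} \<subseteq> fst ` G" and snd: "{0..<g} \<subseteq> snd ` G"
    using rows_columns by (force simp: image_iff Bex_def)+
  have "card {0..<g} \<le> card (fst ` G)" "card {0..<g} \<le> card (snd ` G)"
    using fst snd finite_G by (auto intro!: card_mono simp del: card_atLeastLessThan)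
  then have "card (fst ` G) = card G" "card (snd ` G) = card G"
    using small card_image_le[OF finite_G, of fst] card_image_le[OF finite_G, of snd] by auto
  then have inj: "inj_on fst G" "inj_on snd G"
    using finite_G by (auto intro: eq_card_imp_inj_on)
  \<comment> \<open>These two points share a row or a column with \<open>(0, 0)\<close>.\<close>
  have "(1, 0) \<notin> G" "(0, 1) \<notin> G"
    using inj_onD[OF inj(2), of "(1, 0)" "(0, 0)"] inj_onD[OF inj(1), of "(0, 1)" "(0, 0)"] G_zero by auto
  then have "(1, 0) \<notin> fractal" "(0, 1) \<notin> fractal"
    using stage_digits[of 1 0 _ 0] stage_digits[of 0 1 _ 0] g unfolding fractal_def by auto
  then have no: "(1, 0) \<notin> embZ ` fractal" "(0, 1) \<notin> embZ ` fractal"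
    using mem_embZ[of 1 0 fractal] mem_embZ[of 0 1 fractal] by simp_all
  obtain q where q: "q \<in> G" "q \<noteq> (0, 0)" using gen unfolding is_generator_def by auto
  have "dssf_stage g G 0 \<subseteq> fractal" unfolding fractal_def by (rule UN_upper) simp
  then have "embZ (0, 0) \<in> embZ ` fractal" "embZ q \<in> embZ ` fractal"
    using G_zero q(1) by (intro imageI, auto)+
  then have "(embZ (0, 0), embZ q) \<in> (grid_edges (embZ ` fractal))\<^sup>*"
    using assms unfolding grid_connected_def by blast
  then have "((0, 0), embZ q) \<in> (grid_edges (embZ ` fractal))\<^sup>*" by (simp add: embZ_def)
  moreover have "embZ q \<noteq> (0, 0)" using q(2) by (cases q) (auto simp: embZ_def)
  ultimately obtain z where "((0, 0), z) \<in> grid_edges (embZ ` fractal)"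
    by (metis converse_rtranclE)
  then have z: "z \<in> embZ ` fractal" "z \<in> nbs (0, 0)" unfolding grid_edges_def nbs_def by auto
  have neg: "(0, - 1) \<notin> embZ ` fractal" "(- 1, 0) \<notin> embZ ` fractal"
    unfolding embZ_def by auto
  have "z = (0, 1) \<or> z = (1, 0) \<or> z = (0, - 1) \<or> z = (- 1, 0)" using z(2) by (simp add: nbs_eq)
  then show False using z(1) no neg by (elim disjE) simp_all
qed

text \<open>The numbers whose digit at place \<open>k\<close> is \<open>q\<close> form blocks of
  length \<open>g ^ k\<close>, one in each period of length \<open>g ^ (k + 1)\<close>. Steps of
  length at most \<open>g ^ k\<close> cannot jump over a block.\<close>

lemma adjust_digit:
  fixes x0 D q :: int
  assumes "0 < D" "D \<le> int g ^ k" "0 \<le> q" "q < int g"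
  shows "\<exists>e. 0 \<le> e \<and> e \<le> 2 * int g ^ k * int g \<and> (x0 + D * e) div int g ^ k mod int g = q"
proof -
  define M where "M = int g ^ k"
  have M: "0 < M" "D \<le> M" using assms g unfolding M_def by auto
  \<comment> \<open>\<open>h * (M * int g)\<close> is the first multiple of the period beyond
    \<open>x0\<close>, \<open>t\<close> is the start of the wanted block in that period, and
    \<open>e\<close> is \<open>(t - x0) / D\<close> rounded up.\<close>
  define h where "h = x0 div (M * int g) + 1"
  define t where "t = h * (M * int g) + q * M"
  define e where "e = - ((x0 - t) div D)"
  have pos: "0 < M * int g" using M g by simp
  have qM: "0 \<le> q * M" "q * M + M \<le> M * int g"
  proof -
    show "0 \<le> q * M" using assms M by simp
    have "(q + 1) * M \<le> int g * M" using assms M by (intro mult_right_mono) auto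
    then show "q * M + M \<le> M * int g" by (simp add: algebra_simps)
  qed
  have h: "x0 < h * (M * int g)" "h * (M * int g) \<le> x0 + M * int g"
    unfolding h_def using pos mult_div_mod_eq[of "M * int g" x0]
      pos_mod_sign[OF pos, of x0] pos_mod_bound[OF pos, of x0] by (auto simp: algebra_simps)
  have De: "x0 + D * e = t + (x0 - t) mod D"
    unfolding e_def using mult_div_mod_eq[of D "x0 - t"] by (simp add: algebra_simps)
  have r: "0 \<le> (x0 - t) mod D" "(x0 - t) mod D < M"
    using pos_mod_sign[OF assms(1), of "x0 - t"] pos_mod_bound[OF assms(1), of "x0 - t"] M by linarith+
  have e0: "0 < e"
  proof -
    have "0 < D * e" using De r h qM unfolding t_def by linarith
    then show ?thesis using assms(1) by (simp add: zero_less_mult_iff)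
  qed
  have "e \<le> D * e" using e0 assms(1) by simp
  also have "\<dots> \<le> 2 * M * int g" using De r h qM unfolding t_def by linarith
  finally have e: "e \<le> 2 * M * int g" .
  have "x0 + D * e = (x0 - t) mod D + (h * int g + q) * M"
    unfolding De unfolding t_def by (simp add: algebra_simps)
  then have "(x0 + D * e) div M = h * int g + q"
    using r M by simp
  then have "(x0 + D * e) div M mod int g = q" using assms by simp
  then show ?thesis using e e0 unfolding M_def by (intro exI[of _ e]) simp
qed

text \<open>By Cramer's rule the lattice cone contains every translate of the apex by a multiple of the
  determinant that lies in the cone; such points are dense enough to hit a missing digit.\<close>
lemma no_positive_cone:
  fixes p1 p2 v1 v2 w1 w2 :: int
  assumes nonneg: "0 \<le> v1" "0 \<le> v2" "0 \<le> w1" "0 \<le> w2" and det: "0 < v1 * w2 - v2 * w1"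
    and cone: "\<And>k l :: nat. (p1 + int k * v1 + int l * w1, p2 + int k * v2 + int l * w2) \<in> embZ ` fractal"
  shows False
proof -
  define D where "D = v1 * w2 - v2 * w1"
  have "G \<subset> {0..<g} \<times> {0..<g}" using gen unfolding is_generator_def by argo
  then obtain q' where "q' \<in> {0..<g} \<times> {0..<g}" "q' \<notin> G" by blast
  then obtain q1 q2 where q: "(q1, q2) \<notin> G" "q1 < g" "q2 < g" by (cases q') auto
  \<comment> \<open>Any place with \<open>D \<le> g ^ k\<close> would do.\<close>
  define k where "k = nat D"
  have "D \<le> int g ^ k"
  proof -
    have "k < 2 ^ k" by (rule less_exp)
    also have "\<dots> \<le> g ^ k" using g by (intro power_mono) auto
    finally have "int k \<le> int (g ^ k)" by (simp only: of_nat_le_iff less_imp_le)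
    then show ?thesis using det[folded D_def] unfolding k_def by simp
  qed
  note digit = adjust_digit[OF det[folded D_def] this]
  define B where "B = 2 * int g ^ k * int g"
  have B: "0 \<le> B" unfolding B_def by simp
  \<comment> \<open>The apex is first moved by \<open>D * N\<close> times the sum of both vectors.
    This \<open>N\<close> keeps the coefficients \<open>K\<close> and \<open>L\<close> nonnegative
    for all corrections \<open>e1\<close>, \<open>e2\<close> between \<open>0\<close> and
    \<open>B\<close>.\<close>
  define N where "N = B * (w1 + v2)"
  have N: "0 \<le> N" unfolding N_def using B nonneg by simp
  obtain e1 where e1: "0 \<le> e1" "e1 \<le> B"
      "((p1 + D * (N * (v1 + w1))) + D * e1) div int g ^ k mod int g = int q1"
    using digit[of "int q1" "p1 + D * (N * (v1 + w1))"] q unfolding B_def by auto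
  obtain e2 where e2: "0 \<le> e2" "e2 \<le> B"
      "((p2 + D * (N * (v2 + w2))) + D * e2) div int g ^ k mod int g = int q2"
    using digit[of "int q2" "p2 + D * (N * (v2 + w2))"] q unfolding B_def by auto
  \<comment> \<open>Cramer's rule: \<open>K\<close> and \<open>L\<close> are the coefficients that
    express the correction \<open>D * (e1, e2)\<close> together with the initial displacement of the
    apex by the two vectors.\<close>
  define K where "K = N * D + e1 * w2 - e2 * w1"
  define L where "L = N * D + e2 * v1 - e1 * v2"
  have ND: "N \<le> N * D" using N det unfolding D_def[symmetric] by (simp add: mult_le_cancel_left1)
  have "e2 * w1 \<le> B * w1" "e1 * v2 \<le> B * v2" "0 \<le> e1 * w2" "0 \<le> e2 * v1" "0 \<le> B * w1" "0 \<le> B * v2"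
    using e1 e2 nonneg B by (auto intro: mult_right_mono)
  then have KL: "0 \<le> K" "0 \<le> L"
    using ND unfolding K_def L_def N_def by (auto simp: algebra_simps)
  have eq: "p1 + K * v1 + L * w1 = (p1 + D * (N * (v1 + w1))) + D * e1"
    "p2 + K * v2 + L * w2 = (p2 + D * (N * (v2 + w2))) + D * e2"
    unfolding K_def L_def D_def by (auto simp: algebra_simps)
  then have "((p1 + D * (N * (v1 + w1))) + D * e1, (p2 + D * (N * (v2 + w2))) + D * e2) \<in> embZ ` fractal"
    using cone[of "nat K" "nat L"] KL unfolding eq[symmetric] by simp
  from fractal_digits[OF this, of k] have "(int q1, int q2) \<in> embZ ` G" using e1 e2 by simp
  then show False using q unfolding embZ_def by auto
qed

lemma no_cone:
  fixes p v w :: "int \<times> int"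
  assumes nonneg: "0 \<le> fst v" "0 \<le> snd v" "0 \<le> fst w" "0 \<le> snd w"
    and det: "fst v * snd w \<noteq> snd v * fst w"
    and cone: "\<And>k l :: nat. (fst p + int k * fst v + int l * fst w, snd p + int k * snd v + int l * snd w)
      \<in> embZ ` fractal"
  shows False
proof (cases "0 < fst v * snd w - snd v * fst w")
  case True
  then show ?thesis using no_positive_cone[OF nonneg True] cone by blast
next
  case False
  then have "0 < fst w * snd v - snd w * fst v" using det by (simp add: mult.commute)
  moreover have "(fst p + int k * fst w + int l * fst v, snd p + int k * snd w + int l * snd v) \<in> embZ ` fractal"
    for k l :: nat
    using cone[of l k] by (simp add: algebra_simps)
  ultimately show ?thesis by (rule no_positive_cone[OF nonneg(3,4,1,2)])
qed

text \<open>A box of side \<open>g ^ Suc i\<close> contains \<open>card G ^ Suc i\<close> points, and \<open>g < card G\<close>.\<close>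
lemma not_linear:
  assumes "grid_connected (embZ ` fractal)"
  shows "\<exists>N. C * Suc N < card {p \<in> embZ ` fractal. fst p < int N \<and> snd p < int N}"
proof -
  let ?n = "card G"
  have n: "g < ?n" by (rule card_G[OF assms])
  \<comment> \<open>Bernoulli's inequality for \<open>1 + 1/g\<close>, cleared of denominators and
    combined with \<open>g + 1 \<le> card G\<close>.\<close>
  have growth: "g ^ i * (g + i) \<le> g * ?n ^ i" for i
  proof (induction i)
    case (Suc i)
    have "g ^ Suc i * (g + Suc i) = g * (g ^ i * (g + i)) + g ^ Suc i" by (simp add: algebra_simps)
    also have "\<dots> \<le> g * (g * ?n ^ i) + g ^ Suc i" using Suc by simp
    also have "\<dots> \<le> g * (g * ?n ^ i) + g * ?n ^ i"
      using n by (auto intro!: power_mono)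
    also have "\<dots> = g * (Suc g * ?n ^ i)" by (simp add: algebra_simps)
    also have "\<dots> \<le> g * (?n * ?n ^ i)" using n by (intro mult_le_mono) auto
    finally show ?case by simp
  qed simp
  \<comment> \<open>After multiplication by \<open>g\<close>, the linear bound is at most
    \<open>g ^ Suc i * (2 * C * g)\<close>, so \<open>growth\<close> wins once
    \<open>2 * C * g < g + Suc i\<close>.\<close>
  define i where "i = 2 * C * g + 1"
  define N where "N = g ^ Suc i"
  have "1 \<le> g ^ Suc i" using g by simp
  then have "C * Suc N \<le> C * (2 * g ^ Suc i)" unfolding N_def by (intro mult_le_mono2) simp
  then have "g * (C * Suc N) \<le> g * (C * (2 * g ^ Suc i))" by (rule mult_le_mono2)
  also have "\<dots> = g ^ Suc i * (2 * C * g)" by (simp add: algebra_simps)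
  finally have "g * (C * Suc N) \<le> g ^ Suc i * (2 * C * g)" .
  also have "\<dots> < g ^ Suc i * (g + Suc i)" using g unfolding i_def by (intro mult_strict_left_mono) auto
  also have "\<dots> \<le> g * ?n ^ Suc i" by (rule growth)
  finally have less: "C * Suc N < ?n ^ Suc i" using g by simp
  let ?B = "{p \<in> embZ ` fractal. fst p < int N \<and> snd p < int N}"
  have "embZ ` dssf_stage g G i \<subseteq> ?B"
    using stage_bound[of _ _ i] unfolding fractal_def N_def by (auto simp: embZ_def simp del: power_Suc of_nat_power)
  moreover have "finite ?B"
    by (rule finite_subset[of _ "{0..<int N} \<times> {0..<int N}"]) (auto simp: embZ_def)
  ultimately have "card (embZ ` dssf_stage g G i) \<le> card ?B" by (intro card_mono)
  moreover have "card (embZ ` dssf_stage g G i) = ?n ^ Suc i"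
    using card_stage[of i] card_image[of embZ "dssf_stage g G i"] embZ_inj by (simp add: inj_on_subset)
  ultimately show ?thesis using less by (intro exI[of _ N]) simp
qed

end

section \<open>Window movies\<close>

definition scale :: "int \<Rightarrow> int \<times> int \<Rightarrow> int \<times> int" where
  "scale c p = (c * fst p, c * snd p)"

definition cell :: "int \<Rightarrow> int \<times> int \<Rightarrow> int \<times> int" where
  "cell c x = (fst x div c, snd x div c)"

lemma mem_scaling: "x \<in> scaling c V \<longleftrightarrow> cell c x \<in> V"
  unfolding scaling_def cell_def by (cases x) simp

lemma cell_add_scale: "0 < c \<Longrightarrow> cell c (x + scale c p) = cell c x + p"
  unfolding cell_def scale_def by (simp add: prod_eq_iff)

lemma div_step:
  fixes a c :: int assumes "0 < c" shows "(a + 1) div c = a div c \<or> (a + 1) div c = a div c + 1"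
proof -
  have "a div c \<le> (a + 1) div c" "(a + 1) div c \<le> (a + c) div c"
    using assms by (auto intro: zdiv_mono1)
  moreover have "(a + c) div c = a div c + 1" using div_add_self2[of c a] assms by simp
  ultimately show ?thesis by linarith
qed

lemma cell_adj:
  assumes "0 < c" "grid_adj x z" shows "cell c x = cell c z \<or> grid_adj (cell c x) (cell c z)"
proof -
  obtain a b where x: "x = (a, b)" by (metis prod.exhaust)
  have "z \<in> nbs (a, b)" using assms(2) unfolding nbs_def x by simp
  then consider "z = (a, b + 1)" | "z = (a + 1, b)" | "z = (a, b - 1)" | "z = (a - 1, b)"
    unfolding nbs_eq by blast
  then show ?thesis
  proof cases
    case 1
    then show ?thesis using div_step[OF assms(1), of b] by (auto simp: x cell_def grid_adj_def)
  next
    case 2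
    then show ?thesis using div_step[OF assms(1), of a] by (auto simp: x cell_def grid_adj_def)
  next
    case 3
    then show ?thesis using div_step[OF assms(1), of "b - 1"] by (auto simp: x cell_def grid_adj_def)
  next
    case 4
    then show ?thesis using div_step[OF assms(1), of "a - 1"] by (auto simp: x cell_def grid_adj_def)
  qed
qed

lemma grid_adj_add: "grid_adj (p + s) (q + s) \<longleftrightarrow> grid_adj p q"
  unfolding grid_adj_def by simp

lemma nbs_add: "z \<in> nbs p \<Longrightarrow> z + s \<in> nbs (p + s)"
  unfolding nbs_def by (simp add: grid_adj_add)

lemma finite_cell:
  assumes c: "0 < c" shows "finite {x. cell c x = q}"
proof (rule finite_subset)
  show "{x. cell c x = q} \<subseteq> {fst q * c..<fst q * c + c} \<times> {snd q * c..<snd q * c + c}"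
  proof
    fix x assume "x \<in> {x. cell c x = q}"
    then have "fst q = fst x div c" "snd q = snd x div c" unfolding cell_def by auto
    then have "fst q * c + fst x mod c = fst x" "snd q * c + snd x mod c = snd x" by simp_all
    then have "fst q * c \<le> fst x" "fst x < fst q * c + c" "snd q * c \<le> snd x" "snd x < snd q * c + c"
      using pos_mod_sign[OF c, of "fst x"] pos_mod_bound[OF c, of "fst x"]
        pos_mod_sign[OF c, of "snd x"] pos_mod_bound[OF c, of "snd x"] by linarith+
    then show "x \<in> {fst q * c..<fst q * c + c} \<times> {snd q * c..<snd q * c + c}"
      by (simp add: mem_Times_iff)
  qed
qed simp

text \<open>\<open>f\<close> is one fixed history of the whole shape, from which movies are read
  off; \<open>confined\<close> states what is known about all other histories.\<close>

locale tree_assembly = tile_system T \<sigma> \<tau> + rooted_grid_tree V r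
  for T :: "'l tile set" and \<sigma> \<tau> V r +
  fixes c :: int and f :: "nat \<Rightarrow> 'l config"
  assumes c: "0 < c" and start: "f 0 = \<sigma>" and steps: "\<And>i. step1 T \<tau> (f i) (f (Suc i))"
    and result: "dom (seq_result f) = scaling c V"
    and confined: "\<And>\<gamma>. reach \<gamma> \<Longrightarrow> dom \<gamma> \<subseteq> scaling c V"
begin

abbreviation \<alpha> :: "'l config" where "\<alpha> \<equiv> seq_result f"

definition time :: "int \<times> int \<Rightarrow> nat" where
  "time x = (LEAST i. x \<in> dom (f i))"

lemma mono: "f i \<subseteq>\<^sub>m f (Suc i)"
  using steps[of i] unfolding step1_def by simp

lemma below: "f i \<subseteq>\<^sub>m \<alpha>"
  by (rule seq_result_upper, rule mono)

lemma tile: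
  assumes "cell c x \<in> V" shows "\<exists>t. \<alpha> x = Some t"
proof -
  have "x \<in> dom \<alpha>" using assms unfolding result mem_scaling .
  then show ?thesis by (rule domD)
qed

lemma stable_stage: "stable_assembly T \<tau> (f i)"
  using steps[of i] unfolding step1_def by simp

lemma tiles_in_T: "ran \<alpha> \<subseteq> T"
  by (rule stable_assemblyD, rule stable_seq_result, rule mono, rule stable_stage)

lemma time_le: "x \<in> dom (f i) \<Longrightarrow> time x \<le> i"
  unfolding time_def by (rule Least_le)

lemma time_seed: "x \<in> dom \<sigma> \<Longrightarrow> time x = 0"
  using time_le[of x 0] start by simp

text \<open>At the moment \<open>x\<close> was placed, the tiles already present had to hold it with
  strength \<tau>, and their bonds are unchanged in the limit.\<close>

lemma time_binding:
  assumes x: "cell c x \<in> V" "x \<notin> dom \<sigma>"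
  shows "\<tau> \<le> (\<Sum>z | z \<in> nbs x \<and> cell c z \<in> V \<and> time z < time x. bond \<alpha> x z)"
proof -
  have "x \<in> dom \<alpha>" using x result mem_scaling by simp
  then obtain j where "x \<in> dom (f j)" unfolding dom_seq_result by (rule UN_E)
  then have at: "x \<in> dom (f (time x))" unfolding time_def by (rule LeastI)
  then obtain i where i: "time x = Suc i" using x(2) start by (cases "time x") auto
  have before: "x \<notin> dom (f i)" using time_le[of x i] i by auto
  obtain w t where w: "f (Suc i) = (f i)(w \<mapsto> t)" "\<tau> \<le> binding (f (Suc i)) w"
    using steps[of i] by (elim step1_obtain)
  have "x = w" using at before unfolding i w(1) by (cases "x = w") (simp_all add: domIff)
  let ?D = "{z. z \<in> nbs x \<and> cell c z \<in> V \<and> time z < time x}"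
  let ?E = "nbs x \<inter> dom (f (Suc i))"
  have E: "?E \<subseteq> ?D"
  proof
    fix z assume z: "z \<in> ?E"
    have "z \<noteq> x" using z by (cases x) (auto simp: nbs_eq)
    then have "z \<in> dom (f i)" using z \<open>x = w\<close> unfolding w(1) by (simp add: domIff)
    then have "time z \<le> i" "z \<in> dom \<alpha>" using time_le subsetD[OF map_le_implies_dom_le[OF below]] by simp_all
    then show "z \<in> ?D" using z i result mem_scaling by simp
  qed
  have "\<tau> \<le> (\<Sum>z\<in>?E. bond (f (Suc i)) x z)"
    using w(2) \<open>x = w\<close> binding_inter[of "f (Suc i)" x] by simp
  also have "\<dots> = (\<Sum>z\<in>?E. bond \<alpha> x z)"
  proof (rule sum.cong[OF refl])
    fix z assume "z \<in> ?E"
    then have "f (Suc i) z = \<alpha> z" "f (Suc i) x = \<alpha> x"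
      using below[of "Suc i"] at i unfolding map_le_def by simp_all
    then show "bond (f (Suc i)) x z = bond \<alpha> x z" by (intro bond_cong)
  qed
  also have "\<dots> \<le> (\<Sum>z\<in>?D. bond \<alpha> x z)"
    by (intro sum_mono2 E) (auto intro: finite_subset[OF _ finite_nbs[of x]])
  finally show ?thesis .
qed

text \<open>Two whole cells are taken rather than just their common side. The window is still
  finite, and any adjacency inside the shape that leaves the subtree of \<open>p\<close> lies in it
  (\<open>exit_port\<close>).\<close>

definition ports :: "int \<times> int \<Rightarrow> (int \<times> int) set" where
  "ports p = {x. cell c x = p \<or> cell c x = par p}"

text \<open>Positions are relative to \<open>p\<close> and times enter through their order only;
  otherwise different vertices could hardly share a movie and there would be infinitely
  many.\<close>

definition movie where
  "movie p = (par p - p,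
     {(u, t). u + scale c p \<in> ports p \<and> \<alpha> (u + scale c p) = Some t},
     {(u, v). u + scale c p \<in> ports p \<and> v + scale c p \<in> ports p \<and>
        time (u + scale c p) < time (v + scale c p)})"

lemma finite_ports: "finite (ports p)"
proof -
  have "ports p = {x. cell c x = p} \<union> {x. cell c x = par p}" unfolding ports_def by blast
  then show ?thesis using finite_cell[OF c] by simp
qed

text \<open>The shared clock. It is defined for every position, not only for ports, and at
  corresponding ports of windows with equal movies it shows the same value
  (\<open>movie_rank\<close>).\<close>

definition rank :: "int \<times> int \<Rightarrow> int \<times> int \<Rightarrow> nat" where
  "rank p x = card {z \<in> ports p. time z < time x}"

lemma rank_mono: "time x \<le> time y \<Longrightarrow> rank p x \<le> rank p y"
  unfolding rank_def by (intro card_mono) (auto simp: finite_ports)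

lemma rank_strict: "z \<in> ports p \<Longrightarrow> time z < time x \<Longrightarrow> rank p z < rank p x"
  unfolding rank_def by (intro psubset_card_mono) (auto simp: finite_ports)

section \<open>Comparing two vertices with the same movie\<close>

lemma movie_ports:
  assumes "movie p = movie p'"
  shows "par p - p = par p' - p'" "y + scale c (p - p') \<in> ports p \<longleftrightarrow> y \<in> ports p'"
proof -
  show d: "par p - p = par p' - p'" using assms unfolding movie_def by (rule Pair_inject)
  have "p = p' + (p - p')" "par p = par p' + (p - p')" using d by (simp_all add: algebra_simps)
  then have "cell c y + (p - p') = p \<longleftrightarrow> cell c y = p'" "cell c y + (p - p') = par p \<longleftrightarrow> cell c y = par p'"
    by (metis add_right_cancel)+
  then show "y + scale c (p - p') \<in> ports p \<longleftrightarrow> y \<in> ports p'"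
    unfolding ports_def mem_Collect_eq cell_add_scale[OF c] by simp
qed

lemma movie_tile:
  assumes m: "movie p = movie p'" and V: "p' \<in> V" "par p' \<in> V" and y: "y \<in> ports p'"
  shows "\<alpha> (y + scale c (p - p')) = \<alpha> y"
proof -
  have "cell c y \<in> V" using V y unfolding ports_def by auto
  then obtain t where t: "\<alpha> y = Some t" using tile by blast
  have shift: "y - scale c p' + scale c p = y + scale c (p - p')"
    unfolding scale_def by (simp add: prod_eq_iff algebra_simps)
  have "(y - scale c p', t) \<in> {(u, t). u + scale c p' \<in> ports p' \<and> \<alpha> (u + scale c p') = Some t}"
    using y t by simp
  then have "(y - scale c p', t) \<in> {(u, t). u + scale c p \<in> ports p \<and> \<alpha> (u + scale c p) = Some t}"
    using m unfolding movie_def by (simp only: prod.inject)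
  then show ?thesis using t unfolding mem_Collect_eq prod.case shift by simp
qed

lemma movie_time:
  assumes m: "movie p = movie p'" and y: "y \<in> ports p'" "z \<in> ports p'"
  shows "time (y + scale c (p - p')) < time (z + scale c (p - p')) \<longleftrightarrow> time y < time z"
proof -
  have shift: "y - scale c p' + scale c p = y + scale c (p - p')" for y
    unfolding scale_def by (simp add: prod_eq_iff algebra_simps)
  let ?S = "\<lambda>p. {(u, v). u + scale c p \<in> ports p \<and> v + scale c p \<in> ports p \<and>
        time (u + scale c p) < time (v + scale c p)}"
  have "(y - scale c p', z - scale c p') \<in> ?S p \<longleftrightarrow> (y - scale c p', z - scale c p') \<in> ?S p'"
    using m unfolding movie_def by (simp only: prod.inject)
  then show ?thesis
    using y movie_ports(2)[OF m, of y] movie_ports(2)[OF m, of z]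
    unfolding mem_Collect_eq prod.case shift by simp
qed

lemma movie_rank:
  assumes m: "movie p = movie p'" and y: "y \<in> ports p'"
  shows "rank p (y + scale c (p - p')) = rank p' y"
proof -
  let ?s = "scale c (p - p')"
  have "{z \<in> ports p. time z < time (y + ?s)} = (\<lambda>z. z + ?s) ` {z \<in> ports p'. time z < time y}"
    (is "?A = _ ` ?B")
  proof (intro equalityI subsetI)
    fix z assume "z \<in> ?A"
    then have "z - ?s \<in> ?B"
      using movie_ports(2)[OF m, of "z - ?s"] movie_time[OF m _ y, of "z - ?s"] by simp
    then show "z \<in> (\<lambda>z. z + ?s) ` ?B" by (rule rev_image_eqI) simp
  next
    fix z assume "z \<in> (\<lambda>z. z + ?s) ` ?B"
    then show "z \<in> ?A" using movie_ports(2)[OF m] movie_time[OF m _ y] by auto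
  qed
  then show ?thesis unfolding rank_def by (simp add: card_image)
qed

lemma exit_port:
  assumes "p \<in> V" "cell c x \<in> desc p" "cell c z \<in> V - desc p" "z \<in> nbs x"
  shows "cell c x = p \<and> cell c z = par p"
proof -
  have "cell c x \<noteq> cell c z" using assms by auto
  then have "grid_adj (cell c x) (cell c z)" using cell_adj[OF c, of x z] assms(4) unfolding nbs_def by simp
  from desc_exit[OF assms(1-3) this] show ?thesis unfolding child_def by auto
qed

text \<open>Otherwise consider the first tile \<open>y0\<close> below \<open>p'\<close> that leaves the subtree of \<open>p\<close> when moved along.
  Since the two windows saw the same movie, the tiles outside the subtree of \<open>p\<close> and the moved tiles
  placed before \<open>y0\<close> can be assembled together: both histories are interleaved along the movie, i.e.
  ordered first by the number of port tiles already present and then by time. Hence \<open>y0\<close> can be placed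
  outside the shape.\<close>
lemma movie_subset:
  assumes m: "movie p = movie p'" and p: "(par p, p) \<in> child" and p': "(par p', p') \<in> child"
    and seed: "\<And>x. x \<in> dom \<sigma> \<Longrightarrow> cell c x \<in> V - desc p \<and> cell c x \<notin> desc p'"
    and q: "q \<in> desc p'"
  shows "q + (p - p') \<in> desc p"
proof (rule ccontr)
  assume neg: "q + (p - p') \<notin> desc p"
  define s where "s = scale c (p - p')"
  have shift: "cell c (y + s) = cell c y + (p - p')" for y
    unfolding s_def by (rule cell_add_scale[OF c])
  have V: "p \<in> V" "par p \<in> V" "p' \<in> V" "par p' \<in> V" using p p' unfolding child_def by auto
  have par_notin: "par p \<notin> desc p" "par p' \<notin> desc p'"
    using desc_depth[of "par p" p] desc_depth[of "par p'" p'] child_depth[OF p] child_depth[OF p'] by auto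
  have sub': "desc p' \<subseteq> V" by (rule desc_subset[OF V(3)])
  define E where "E = {y. cell c y \<in> desc p' \<and> cell c (y + s) \<notin> desc p}"
  have "cell c (scale c q) = q" using c by (simp add: cell_def scale_def)
  then have "scale c q \<in> E" using q neg unfolding E_def mem_Collect_eq shift by simp
  then obtain y0 where y0: "y0 \<in> E" and first: "\<And>y. y \<in> E \<Longrightarrow> time y0 \<le> time y"
    using ex_has_least_nat[of "\<lambda>y. y \<in> E" "scale c q" time] by blast
  have y0': "cell c y0 \<in> desc p'" "cell c (y0 + s) \<notin> desc p" using y0 unfolding E_def by auto
  have y0_port: "y0 \<notin> ports p'"
  proof
    assume "y0 \<in> ports p'"
    then have "cell c y0 = p'" using y0'(1) par_notin(2) unfolding ports_def by auto
    then show False using y0'(2) unfolding shift by simp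
  qed
  have unseeded: "y \<notin> dom \<sigma>" if "cell c y \<in> desc p'" for y using seed[of y] that by auto
  define J where "J = {y. cell c y \<in> desc p' \<and> (y = y0 \<or> time y < time y0)}"
  have J_le: "time y \<le> time y0" if "y \<in> J" for y using that unfolding J_def by auto
  have J_in: "cell c (y + s) \<in> desc p" if "y \<in> J" "y \<noteq> y0" for y
    using that first[of y] unfolding J_def E_def by auto

  \<comment> \<open>Leaving the subtree of \<open>p\<close> must be upgraded to leaving the shape.
    If the moved \<open>y0\<close> were still in the shape, a tile supporting \<open>y0\<close>
    would be moved into the subtree of \<open>p\<close>, so the moved \<open>y0\<close> would lie in
    the cell above \<open>p\<close>. Then \<open>y0\<close> would be a port.\<close>
  have y0_out: "cell c (y0 + s) \<notin> V"
  proof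
    assume inV: "cell c (y0 + s) \<in> V"
    have "\<tau> \<le> (\<Sum>z | z \<in> nbs y0 \<and> cell c z \<in> V \<and> time z < time y0. bond \<alpha> y0 z)"
      by (rule time_binding) (use y0'(1) sub' unseeded in auto)
    then have "{z. z \<in> nbs y0 \<and> cell c z \<in> V \<and> time z < time y0} \<noteq> {}"
      using tau_pos by (intro notI) simp
    then obtain z where z: "z \<in> nbs y0" "cell c z \<in> V" "time z < time y0" by blast
    have zJ: "cell c z \<in> desc p'"
      using exit_port[OF V(3) y0'(1) _ z(1)] z(2) y0_port unfolding ports_def by auto
    then have "z \<notin> E" using first[of z] z(3) by auto
    then have "cell c (z + s) \<in> desc p" using zJ unfolding E_def by simp
    moreover have "y0 + s \<in> nbs (z + s)"
      by (rule nbs_add) (use z(1) grid_adj_commute in \<open>simp add: nbs_def\<close>)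
    ultimately have "cell c (y0 + s) = par p" using exit_port[OF V(1)] inV y0'(2) by blast
    then have "y0 + s \<in> ports p" unfolding ports_def by simp
    then show False using y0_port movie_ports(2)[OF m, of y0] unfolding s_def by simp
  qed

  \<comment> \<open>The bound stops the outside history at the clock value of \<open>y0\<close>: a
    later outside tile might rest on a tile below \<open>p\<close> whose counterpart below
    \<open>p'\<close> comes after \<open>y0\<close> and is not moved.\<close>
  define Out where "Out = {x. cell c x \<in> V - desc p \<and> rank p x \<le> rank p' y0}"
  define \<beta> where "\<beta> x = (if x \<in> Out then \<alpha> x else if x - s \<in> J then \<alpha> (x - s) else None)" for x
  \<comment> \<open>On one side of the window the clock never decreases and time breaks ties. Across
    the window times are not comparable, but there the supporting tile is a port, so the clock
    strictly increases.\<close>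
  define \<rho> where "\<rho> x = (if cell c x \<in> V - desc p then (rank p x, time x)
    else (rank p' (x - s), time (x - s)))" for x
  have moved_out: "cell c (y + s) \<notin> V - desc p" if "y \<in> J" for y
    using J_in[OF that] y0_out by (cases "y = y0") auto
  have \<beta>_out: "\<beta> x = \<alpha> x" "\<rho> x = (rank p x, time x)" if "x \<in> Out" for x
    using that unfolding \<beta>_def \<rho>_def Out_def by auto
  have \<beta>_moved: "\<beta> (y + s) = \<alpha> y" "\<rho> (y + s) = (rank p' y, time y)" if "y \<in> J" for y
    using that moved_out[OF that] unfolding \<beta>_def \<rho>_def Out_def by auto
  have dom_out: "x \<in> dom \<beta>" if "x \<in> Out" for x
    using \<beta>_out(1)[OF that] tile[of x] that unfolding Out_def by (simp add: domIff)
  have dom_moved: "y + s \<in> dom \<beta>" if "y \<in> J" for y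
  proof -
    have "cell c y \<in> V" using that sub' unfolding J_def by auto
    then show ?thesis using \<beta>_moved(1)[OF that] tile[of y] by (simp add: domIff)
  qed
  have dom_cases: "x \<in> Out \<or> x - s \<in> J" if "x \<in> dom \<beta>" for x
    using that unfolding \<beta>_def by (auto split: if_splits simp: domIff)

  have "\<exists>\<gamma>. reach \<gamma> \<and> y0 + s \<in> dom \<gamma>"
  proof (rule reach_by_rank[where \<beta> = \<beta> and rank = \<rho>])
    show "\<sigma> \<subseteq>\<^sub>m \<beta>"
    proof (rule map_leI)
      fix x t assume x: "\<sigma> x = Some t"
      then have dom: "x \<in> dom \<sigma>" by (rule domI)
      have "rank p x = 0" unfolding rank_def time_seed[OF dom] by simp
      then have "x \<in> Out" using seed[OF dom] unfolding Out_def by simp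
      moreover have "\<alpha> x = Some t" using map_leD[OF below[of 0]] x start by simp
      ultimately show "\<beta> x = Some t" using \<beta>_out(1) by simp
    qed
    show "ran \<beta> \<subseteq> T"
    proof
      fix t assume "t \<in> ran \<beta>"
      then obtain x where "\<beta> x = Some t" unfolding ran_def by blast
      then have "\<alpha> x = Some t \<or> \<alpha> (x - s) = Some t" unfolding \<beta>_def by (auto split: if_splits)
      then have "t \<in> ran \<alpha>" using ranI by metis
      then show "t \<in> T" by (rule subsetD[OF tiles_in_T])
    qed
    show "y0 + s \<in> dom \<beta>" using y0'(1) by (intro dom_moved) (simp add: J_def)
    fix x assume x: "x \<in> dom \<beta> - dom \<sigma>"
    let ?L = "less_than <*lex*> less_than"
    let ?D = "{z. z \<in> nbs x \<and> z \<in> dom \<beta> \<and> (\<rho> z, \<rho> x) \<in> ?L}"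
    have finD: "finite ?D" by (rule finite_subset[OF _ finite_nbs[of x]]) auto
    show "\<tau> \<le> (\<Sum>z\<in>?D. bond \<beta> x z)"
    proof (cases "x \<in> Out")
      case True
      let ?C = "{z. z \<in> nbs x \<and> cell c z \<in> V \<and> time z < time x}"
      have xV: "cell c x \<in> V" "cell c x \<notin> desc p" "rank p x \<le> rank p' y0"
        using True unfolding Out_def by auto
      have dep: "z \<in> ?D \<and> \<beta> z = \<alpha> z" if z: "z \<in> ?C" for z
      proof (cases "cell c z \<in> desc p")
        case False
        have "rank p z \<le> rank p x" using z by (intro rank_mono) auto
        then have "z \<in> Out" using z False xV(3) unfolding Out_def by auto
        then show ?thesis
          using z dom_out \<beta>_out True \<open>rank p z \<le> rank p x\<close> by auto
      next
        case in_p: True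
        \<comment> \<open>The support \<open>z\<close> lies across the window and is a port below.
          In \<beta> its place is taken by the moved tile, which is the same tile; the clock shows
          that its counterpart precedes \<open>y0\<close> and so was moved.\<close>
        have "x \<in> nbs z" using z grid_adj_commute by (simp add: nbs_def)
        then have cells: "cell c z = p" "cell c x = par p"
          using exit_port[OF V(1) in_p] xV by blast+
        define y where "y = z - s"
        have yz: "y + s = z" unfolding y_def by simp
        have "z \<in> ports p" using cells unfolding ports_def by simp
        then have y: "y \<in> ports p'" using movie_ports(2)[OF m, of y] yz unfolding s_def by simp
        have cy: "cell c y = p'" using shift[of y] cells unfolding yz by (simp add: algebra_simps)
        have less: "rank p' y < rank p x"
          using movie_rank[OF m y] yz rank_strict[OF \<open>z \<in> ports p\<close>, of x] z unfolding s_def by simp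
        then have "rank p' y < rank p' y0" using xV(3) by simp
        then have "time y < time y0" using rank_mono[of y0 y p'] by (meson leD not_le_imp_less)
        then have yJ: "y \<in> J" using cy unfolding J_def by simp
        have "\<beta> z = \<alpha> z"
          using \<beta>_moved(1)[OF yJ] movie_tile[OF m V(3,4) y] yz unfolding s_def by simp
        moreover have "(\<rho> z, \<rho> x) \<in> ?L"
          using \<beta>_moved(2)[OF yJ] \<beta>_out(2)[OF True] less yz by simp
        ultimately show ?thesis using dom_moved[OF yJ] z yz by simp
      qed
      have "\<tau> \<le> (\<Sum>z\<in>?C. bond \<alpha> x z)" using x xV(1) by (intro time_binding) auto
      also have "\<dots> = (\<Sum>z\<in>?C. bond \<beta> x z)"
      proof (rule sum.cong[OF refl])
        fix z assume "z \<in> ?C"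
        from dep[OF this] show "bond \<alpha> x z = bond \<beta> x z" using \<beta>_out(1)[OF True] by (intro bond_cong) simp_all
      qed
      also have "\<dots> \<le> (\<Sum>z\<in>?D. bond \<beta> x z)" using dep by (intro sum_mono2 finD) auto
      finally show ?thesis .
    next
      case False
      define y where "y = x - s"
      have xy: "x = y + s" unfolding y_def by simp
      have yJ: "y \<in> J" using x dom_cases[of x] False unfolding y_def by auto
      then have cy: "cell c y \<in> desc p'" unfolding J_def by simp
      let ?C = "{z. z \<in> nbs y \<and> cell c z \<in> V \<and> time z < time y}"
      have dep: "z + s \<in> ?D \<and> \<beta> (z + s) = \<alpha> z" if z: "z \<in> ?C" for z
      proof -
        have nb: "z + s \<in> nbs x" using z nbs_add unfolding xy by auto
        show ?thesis
        proof (cases "cell c z \<in> desc p'")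
          case True
          then have zJ: "z \<in> J" using z J_le[OF yJ] unfolding J_def by auto
          have "rank p' z \<le> rank p' y" using z by (intro rank_mono) auto
          then have "(\<rho> (z + s), \<rho> x) \<in> ?L"
            using \<beta>_moved(2)[OF zJ] \<beta>_moved(2)[OF yJ] z unfolding xy by auto
          then show ?thesis using nb dom_moved[OF zJ] \<beta>_moved(1)[OF zJ] by simp
        next
          case False
          \<comment> \<open>Here the support is a port in the cell above \<open>p'\<close>. Its
            translate in the cell above \<open>p\<close> carries the same tile and belongs to
            \<open>Out\<close>, as its clock value is below that of \<open>y0\<close>.\<close>
          have cells: "cell c y = p'" "cell c z = par p'"
            using exit_port[OF V(3) cy, of z] z False by blast+
          have port: "z \<in> ports p'" using cells unfolding ports_def by simp
          have "rank p (z + s) = rank p' z" unfolding s_def by (rule movie_rank[OF m port])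
          moreover have "rank p' z < rank p' y" using rank_strict[OF port] z by simp
          moreover have "rank p' y \<le> rank p' y0" by (rule rank_mono[OF J_le[OF yJ]])
          ultimately have less: "rank p (z + s) < rank p' y" "rank p (z + s) \<le> rank p' y0" by simp_all
          have "par p' + (p - p') = par p" using movie_ports(1)[OF m] by (simp add: algebra_simps)
          then have "cell c (z + s) = par p" using shift[of z] cells(2) by simp
          then have out: "z + s \<in> Out" using V par_notin less(2) unfolding Out_def by simp
          have "\<alpha> (z + s) = \<alpha> z" unfolding s_def by (rule movie_tile[OF m V(3,4) port])
          moreover have "(\<rho> (z + s), \<rho> x) \<in> ?L"
            using \<beta>_out(2)[OF out] \<beta>_moved(2)[OF yJ] less(1) unfolding xy by simp
          ultimately show ?thesis using nb dom_out[OF out] \<beta>_out(1)[OF out] by simp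
        qed
      qed
      have "\<tau> \<le> (\<Sum>z\<in>?C. bond \<alpha> y z)" using cy sub' unseeded by (intro time_binding) auto
      also have "\<dots> = (\<Sum>z\<in>?C. bond \<beta> x (z + s))"
      proof (rule sum.cong[OF refl])
        fix z assume "z \<in> ?C"
        from dep[OF this] show "bond \<alpha> y z = bond \<beta> x (z + s)"
          unfolding xy using bond_translate[of \<beta> y s \<alpha> z] \<beta>_moved(1)[OF yJ] by simp
      qed
      also have "\<dots> = (\<Sum>z\<in>(\<lambda>z. z + s) ` ?C. bond \<beta> x z)"
        by (subst sum.reindex) (simp_all add: o_def)
      also have "\<dots> \<le> (\<Sum>z\<in>?D. bond \<beta> x z)"
      proof (rule sum_mono2[OF finD image_subsetI])
        fix z assume "z \<in> ?C"
        from dep[OF this] show "z + s \<in> ?D" by (rule conjunct1)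
      qed simp
      finally show ?thesis .
    qed
  qed
  then obtain \<gamma> where \<gamma>: "reach \<gamma>" "y0 + s \<in> dom \<gamma>" by blast
  then have "y0 + s \<in> scaling c V" using confined by (metis subsetD)
  then show False using y0_out mem_scaling by simp
qed

end

section \<open>Repetition along infinite branches\<close>

context tree_assembly
begin

lemma movie_shift:
  assumes "movie p = movie p'" "(par p, p) \<in> child" "(par p', p') \<in> child"
    and seed: "\<And>x. x \<in> dom \<sigma> \<Longrightarrow> cell c x \<in> V \<and> cell c x \<notin> desc p \<and> cell c x \<notin> desc p'"
  shows "q \<in> desc p \<longleftrightarrow> q + (p' - p) \<in> desc p'"
proof
  assume "q \<in> desc p"
  then show "q + (p' - p) \<in> desc p'"
    using movie_subset[OF assms(1)[symmetric] assms(3,2) _ \<open>q \<in> desc p\<close>] seed by blast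
next
  assume "q + (p' - p) \<in> desc p'"
  then have "q + (p' - p) + (p - p') \<in> desc p"
    using movie_subset[OF assms(1-3)] seed by blast
  then show "q \<in> desc p" by (simp add: algebra_simps)
qed

text \<open>Seen from \<open>p\<close>, all ports lie over the origin or one of its four neighbours,
  hence in one finite set.\<close>

lemma finite_movies: "finite (movie ` {p. (par p, p) \<in> child})"
proof (rule finite_subset)
  define W where "W = {u. cell c u = 0} \<union> (\<Union>q\<in>nbs 0. {u. cell c u = q})"
  let ?M = "nbs 0 \<times> Pow (W \<times> T) \<times> Pow (W \<times> W)"
  have "finite W" unfolding W_def using finite_cell[OF c] by simp
  then show "finite ?M" using finite_tiles by simp
  show "movie ` {p. (par p, p) \<in> child} \<subseteq> ?M"
  proof (rule image_subsetI)
    fix p assume "p \<in> {p. (par p, p) \<in> child}"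
    then have "grid_adj p (par p)"
      using child_adj[of "par p" p] grid_adj_commute[of p "par p"] by simp
    then have "grid_adj (p + - p) (par p + - p)" by (simp only: grid_adj_add)
    then have d: "par p - p \<in> nbs 0" unfolding nbs_def by simp
    have W: "u \<in> W" if "u + scale c p \<in> ports p" for u
    proof -
      have "cell c u = 0 \<or> cell c u = par p - p"
        using that unfolding ports_def mem_Collect_eq cell_add_scale[OF c] by (auto simp: algebra_simps)
      then show ?thesis using d unfolding W_def by auto
    qed
    have T: "t \<in> T" if "\<alpha> u = Some t" for u t
    proof -
      have "t \<in> ran \<alpha>" using that by (rule ranI)
      then show ?thesis by (rule subsetD[OF tiles_in_T])
    qed
    show "movie p \<in> ?M"
      unfolding movie_def
    proof (intro SigmaI PowI d subsetI)
      fix e assume "e \<in> {(u, t). u + scale c p \<in> ports p \<and> \<alpha> (u + scale c p) = Some t}"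
      then show "e \<in> W \<times> T" using W T by (cases e) blast
    next
      fix e assume "e \<in> {(u, v). u + scale c p \<in> ports p \<and> v + scale c p \<in> ports p \<and>
        time (u + scale c p) < time (v + scale c p)}"
      then show "e \<in> W \<times> W" using W by (cases e) blast
    qed
  qed
qed

text \<open>Pigeonhole on the movies along the branch, restricted to vertices deeper than every cell
  with a seed tile. The parameter \<open>n\<close> lets the repetition start as deep as
  desired.\<close>

lemma ray_repeat:
  assumes ray: "\<And>i. (x i, x (Suc i)) \<in> child"
  shows "\<exists>i j. n \<le> i \<and> i < j \<and> (\<forall>q. q \<in> desc (x i) \<longleftrightarrow> q + (x j - x i) \<in> desc (x j))"
proof -
  have "finite ((depth \<circ> cell c) ` dom \<sigma>)" using finite_seed by (rule finite_imageI)
  then obtain m where "\<And>d. d \<in> (depth \<circ> cell c) ` dom \<sigma> \<Longrightarrow> d \<le> m"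
    using finite_nat_set_iff_bounded_le by metis
  then have m: "depth (cell c y) \<le> m" if "y \<in> dom \<sigma>" for y using that by auto
  define A where "A = {i. n \<le> i \<and> m < i}"
  have up: "(par (x i), x i) \<in> child" if mi: "m < i" for i
  proof -
    obtain k where "i = Suc k" using mi by (cases i) auto
    then show ?thesis using ray[of k] unfolding child_def by auto
  qed
  have "A = {max n (Suc m)..}" unfolding A_def by auto
  then have "infinite A" using infinite_Ici by simp
  moreover have "finite ((\<lambda>i. movie (x i)) ` A)"
    by (rule finite_subset[OF _ finite_movies]) (use up in \<open>auto simp: A_def\<close>)
  ultimately have "\<not> inj_on (\<lambda>i. movie (x i)) A" using finite_imageD by metis
  then obtain i0 j0 where "i0 \<in> A" "j0 \<in> A" "i0 \<noteq> j0" "movie (x i0) = movie (x j0)"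
    unfolding inj_on_def by blast
  then obtain i j where ij: "i \<in> A" "j \<in> A" "i < j" "movie (x i) = movie (x j)"
    by (metis nat_neq_iff)
  have seed: "cell c y \<in> V \<and> cell c y \<notin> desc (x k)" if "y \<in> dom \<sigma>" "k \<in> A" for y k
  proof
    have "reach \<sigma>" unfolding reach_def by simp
    from subsetD[OF confined[OF this] that(1)] show "cell c y \<in> V" unfolding mem_scaling .
    show "cell c y \<notin> desc (x k)"
      using desc_depth[of "cell c y" "x k"] m[OF that(1)] ray_depth[of x k, OF ray] that(2)
      unfolding A_def by auto
  qed
  have "q \<in> desc (x i) \<longleftrightarrow> q + (x j - x i) \<in> desc (x j)" for q
  proof (rule movie_shift[OF ij(4)])
    show "(par (x i), x i) \<in> child" "(par (x j), x j) \<in> child" using up ij unfolding A_def by auto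
    show "cell c y \<in> V \<and> cell c y \<notin> desc (x i) \<and> cell c y \<notin> desc (x j)" if "y \<in> dom \<sigma>" for y
      using seed[OF that ij(1)] seed[OF that ij(2)] by simp
  qed
  moreover have "n \<le> i" using ij(1) unfolding A_def by simp
  ultimately show ?thesis using ij(3) by blast
qed

end

section \<open>Repeating subtrees force a two-dimensional lattice cone\<close>

lemma scale_Suc: "scale (int (Suc k)) v = scale (int k) v + v"
  unfolding scale_def by (simp add: prod_eq_iff algebra_simps)

lemma scale_0: "scale (int 0) v = 0"
  unfolding scale_def by (simp add: prod_eq_iff)

lemma iterate_shift:
  assumes "\<And>q. q \<in> S \<Longrightarrow> q + v \<in> S" "q \<in> S"
  shows "q + scale (int k) v \<in> S"
proof (induction k)
  case 0
  then show ?case using assms(2) unfolding scale_0 by simp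
next
  case (Suc k)
  from assms(1)[OF this] show ?case unfolding scale_Suc by (simp only: add.assoc)
qed

text \<open>A negative coordinate of \<open>v\<close> would drive iterated translates out of the
  quadrant.\<close>

lemma shift_nonneg:
  fixes v :: "int \<times> int"
  assumes "\<And>p. p \<in> S \<Longrightarrow> 0 \<le> fst p \<and> 0 \<le> snd p" "\<And>q. q \<in> S \<Longrightarrow> q + v \<in> S" "q \<in> S"
  shows "0 \<le> fst v \<and> 0 \<le> snd v"
proof -
  have slope: "0 \<le> b" if b: "\<And>k. 0 \<le> a + int k * b" for a b
  proof (rule ccontr)
    assume "\<not> 0 \<le> b"
    moreover have a: "0 \<le> a" using b[of 0] by simp
    ultimately have "(a + 1) * b \<le> (a + 1) * (- 1)" by (intro mult_left_mono) linarith+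
    moreover have "0 \<le> a + (a + 1) * b" using b[of "nat (a + 1)"] a by simp
    ultimately show False by simp
  qed
  have "q + scale (int k) v \<in> S" for k using assms(2,3) by (rule iterate_shift)
  from assms(1)[OF this] have "0 \<le> fst q + int k * fst v" "0 \<le> snd q + int k * snd v" for k
    unfolding scale_def by simp_all
  then show ?thesis using slope by blast
qed

definition box :: "(int \<times> int) set \<Rightarrow> nat \<Rightarrow> (int \<times> int) set" where
  "box S N = {p \<in> S. fst p < int N \<and> snd p < int N}"

text \<open>The boxes have no lower bound of their own; they are finite for subsets of the quadrant,
  where the notion is applied. With \<open>Suc N\<close> instead of \<open>N\<close>, the case
  \<open>N = 0\<close> needs no exception.\<close>

definition linear_growth :: "(int \<times> int) set \<Rightarrow> bool" where
  "linear_growth S \<longleftrightarrow> (\<exists>C. \<forall>N. card (box S N) \<le> C * Suc N)"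

lemma linear_growth_single: "linear_growth {p}"
proof -
  have "card (box {p} N) \<le> 1 * Suc N" for N
  proof -
    have "box {p} N \<subseteq> {p}" unfolding box_def by auto
    then have "card (box {p} N) \<le> card {p}" by (intro card_mono) simp_all
    then show ?thesis by simp
  qed
  then show ?thesis unfolding linear_growth_def by blast
qed

lemma linear_growth_union:
  assumes "linear_growth A" "linear_growth B" shows "linear_growth (A \<union> B)"
proof -
  obtain C where C: "\<And>N. card (box A N) \<le> C * Suc N" using assms(1) unfolding linear_growth_def by blast
  obtain D where D: "\<And>N. card (box B N) \<le> D * Suc N" using assms(2) unfolding linear_growth_def by blast
  have "card (box (A \<union> B) N) \<le> (C + D) * Suc N" for N
  proof -
    have "box (A \<union> B) N = box A N \<union> box B N" unfolding box_def by auto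
    then have "card (box (A \<union> B) N) \<le> card (box A N) + card (box B N)" by (simp add: card_Un_le)
    also have "\<dots> \<le> C * Suc N + D * Suc N" by (intro add_mono C D)
    finally show ?thesis by (simp only: add_mult_distrib)
  qed
  then show ?thesis unfolding linear_growth_def by blast
qed

text \<open>Some coordinate of \<open>v\<close> is at least 1, so a translate by \<open>k\<close>
  times \<open>v\<close> can meet the box of size \<open>N\<close> only if
  \<open>k \<le> N\<close>.\<close>

lemma linear_growth_translates:
  assumes fin: "finite Q" and Q: "\<And>p. p \<in> Q \<Longrightarrow> 0 \<le> fst p \<and> 0 \<le> snd p"
    and v: "0 \<le> fst v" "0 \<le> snd v" "v \<noteq> 0"
    and S: "\<And>q. q \<in> S \<Longrightarrow> \<exists>k. \<exists>q0\<in>Q. q = q0 + scale (int k) v"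
  shows "linear_growth S"
proof -
  have "card (box S N) \<le> card Q * Suc N" for N
  proof -
    have "box S N \<subseteq> (\<lambda>(q, k). q + scale (int k) v) ` (Q \<times> {..N})"
    proof
      fix p assume p: "p \<in> box S N"
      then obtain k q where q: "q \<in> Q" "p = q + scale (int k) v" using S[of p] unfolding box_def by auto
      have "fst p = fst q + int k * fst v" "snd p = snd q + int k * snd v"
        unfolding q(2) scale_def by simp_all
      then have less: "int k * fst v < int N" "int k * snd v < int N"
        using p Q[OF q(1)] unfolding box_def by simp_all
      have "1 \<le> fst v \<or> 1 \<le> snd v" using v by (auto simp: prod_eq_iff)
      then have "int k * 1 \<le> int k * fst v \<or> int k * 1 \<le> int k * snd v"
        by (metis mult_left_mono of_nat_0_le_iff)
      then have "k \<le> N" using less by linarith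
      then show "p \<in> (\<lambda>(q, k). q + scale (int k) v) ` (Q \<times> {..N})"
        using q by (intro rev_image_eqI[of "(q, k)"]) simp_all
    qed
    then have "card (box S N) \<le> card (Q \<times> {..N})"
      using fin by (intro surj_card_le) auto
    then show ?thesis by (simp add: card_cartesian_product)
  qed
  then show ?thesis unfolding linear_growth_def by blast
qed

text \<open>Cross-multiplication: \<open>k\<close> and \<open>l\<close> are the same coordinate of
  \<open>w\<close> and of \<open>v\<close>, chosen nonzero in \<open>v\<close>.\<close>

lemma parallel_multiples:
  assumes "0 \<le> fst v" "0 \<le> snd v" "0 \<le> fst w" "0 \<le> snd w" "v \<noteq> 0"
    and "fst v * snd w = snd v * fst w"
  shows "\<exists>k l. 0 < l \<and> scale (int k) v = scale (int l) w"
proof (cases "fst v = 0")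
  case False
  then show ?thesis using assms
    by (intro exI[of _ "nat (fst w)"] exI[of _ "nat (fst v)"]) (auto simp: scale_def mult.commute)
next
  case True
  then have "snd v \<noteq> 0" using assms(5) by (auto simp: prod_eq_iff)
  then show ?thesis using assms True
    by (intro exI[of _ "nat (snd w)"] exI[of _ "nat (snd v)"]) (auto simp: scale_def mult.commute)
qed

section \<open>Two independent periods and the contradiction\<close>

context tree_assembly
begin

lemma no_tree_assembly:
  assumes nonneg: "\<And>p. p \<in> V \<Longrightarrow> 0 \<le> fst p \<and> 0 \<le> snd p"
    and growth: "\<not> linear_growth V"
    and no_cone: "\<And>p v w. \<lbrakk>0 \<le> fst v; 0 \<le> snd v; 0 \<le> fst w; 0 \<le> snd w; fst v * snd w \<noteq> snd v * fst w;
      \<And>k l. p + scale (int k) v + scale (int l) w \<in> V\<rbrakk> \<Longrightarrow> False"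
  shows False
proof -
  have "\<not> linear_growth (desc r)" using growth desc_root by simp
  from ray_exists[of linear_growth, OF linear_growth_single linear_growth_union root this]
  obtain x where x: "\<And>i. x i \<in> V" "\<And>i. (x i, x (Suc i)) \<in> child" "\<And>i. \<not> linear_growth (desc (x i))"
    by blast
  obtain i j where ij: "i < j" "\<And>q. q \<in> desc (x i) \<longleftrightarrow> q + (x j - x i) \<in> desc (x j)"
    using ray_repeat[of x 0, OF x(2)] by blast
  define p p' v where "p = x i" and "p' = x j" and "v = x j - x i"
  have pp': "p' \<in> desc p" using ray_desc[of x i j, OF x(2)] ij(1) unfolding p_def p'_def by simp
  have pV: "p \<in> V" unfolding p_def by (rule x(1))
  have sub: "desc p \<subseteq> V" "desc p' \<subseteq> desc p" using desc_subset[OF pV] desc_trans[OF pp'] by auto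
  have shift: "q \<in> desc p \<longleftrightarrow> q + v \<in> desc p'" for q using ij(2) unfolding p_def p'_def v_def .
  have step: "q + v \<in> desc p" if "q \<in> desc p" for q using that shift sub by blast
  have v0: "v \<noteq> 0"
    using ray_depth[of x i, OF x(2)] ray_depth[of x j, OF x(2)] ij(1) unfolding v_def by auto
  have v: "0 \<le> fst v" "0 \<le> snd v"
    using shift_nonneg[of "desc p" v p] nonneg sub(1) step by auto
  define Q where "Q = desc p - desc p'"
  \<comment> \<open>Subtract \<open>v\<close> as long as the point lies below \<open>p'\<close>; the
    coordinate sum is nonnegative and decreases.\<close>
  have layers: "\<exists>k. \<exists>q0\<in>Q. q = q0 + scale (int k) v" if "q \<in> desc p" for q
    using that
  proof (induction "nat (fst q + snd q)" arbitrary: q rule: less_induct)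
    case less
    show ?case
    proof (cases "q \<in> desc p'")
      case False
      then show ?thesis using less.prems unfolding Q_def
        by (intro exI[of _ 0] bexI[of _ q]) (simp_all add: scale_def prod_eq_iff)
    next
      case True
      then have q: "q - v \<in> desc p" using shift[of "q - v"] by simp
      have "0 < fst v + snd v" using v v0 by (auto simp: prod_eq_iff)
      moreover have "0 \<le> fst (q - v) \<and> 0 \<le> snd (q - v)" using nonneg q sub(1) by blast
      ultimately have "nat (fst (q - v) + snd (q - v)) < nat (fst q + snd q)" by simp
      from less.hyps[OF this q] obtain k q0 where "q0 \<in> Q" "q - v = q0 + scale (int k) v" by blast
      then show ?thesis
        by (intro exI[of _ "Suc k"] bexI[of _ q0]) (simp_all only: scale_Suc, simp add: algebra_simps)
    qed
  qed
  have "infinite Q"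
  proof
    assume "finite Q"
    moreover have "0 \<le> fst q \<and> 0 \<le> snd q" if "q \<in> Q" for q using that nonneg sub(1) unfolding Q_def by blast
    ultimately have "linear_growth (desc p)" using v v0 layers by (rule linear_growth_translates)
    then show False using x(3) unfolding p_def by simp
  qed
  then have "\<not> finite (desc p - desc p')" unfolding Q_def .
  \<comment> \<open>Smallness now means being finite outside the subtree of \<open>p'\<close>, so
    the new branch never enters that subtree.\<close>
  from ray_exists[of "\<lambda>S. finite (S - desc p')", OF _ _ pV this]
  obtain y where y: "y 0 = p" "\<And>i. (y i, y (Suc i)) \<in> child" "\<And>i. infinite (desc (y i) - desc p')"
    by (auto simp: Un_Diff)
  \<comment> \<open>Starting deeper than \<open>p'\<close> ensures that \<open>y m\<close> is not an
    ancestor of \<open>p'\<close>; its subtree is then disjoint from that of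
    \<open>p'\<close>.\<close>
  obtain m n where mn: "Suc (depth p') \<le> m" "m < n"
    "\<And>q. q \<in> desc (y m) \<longleftrightarrow> q + (y n - y m) \<in> desc (y n)"
    using ray_repeat[of y "Suc (depth p')", OF y(2)] by blast
  define a w where "a = y m" and "w = y n - y m"
  have ap: "a \<in> desc p" using ray_desc[of y 0 m, OF y(2)] y(1) unfolding a_def by simp
  have "p' \<notin> desc a"
    using desc_depth[of p' a] ray_depth[of y m, OF y(2)] mn(1) unfolding a_def by auto
  moreover have "a \<notin> desc p'"
  proof
    assume "a \<in> desc p'"
    then have empty: "desc a - desc p' = {}" using desc_trans by blast
    from y(3)[of m] show False unfolding a_def[symmetric] empty by simp
  qed
  ultimately have disj: "desc a \<inter> desc p' = {}" by (intro desc_disjoint)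
  have "y n \<in> desc a" using ray_desc[of y m n, OF y(2)] mn(2) unfolding a_def by simp
  then have stepw: "q + w \<in> desc a" if "q \<in> desc a" for q
    using mn(3)[of q] that desc_trans unfolding a_def w_def by blast
  have subp: "desc a \<subseteq> desc p" by (rule desc_trans[OF ap])
  have w0: "w \<noteq> 0"
    using ray_depth[of y m, OF y(2)] ray_depth[of y n, OF y(2)] mn(2) unfolding w_def by auto
  have w: "0 \<le> fst w" "0 \<le> snd w"
    using shift_nonneg[of "desc a" w a] nonneg sub(1) subp stepw by auto
  have lattice: "a + scale (int l) w \<in> desc a" for l
    by (rule iterate_shift[OF stepw]) simp_all
  have "fst v * snd w = snd v * fst w"
  proof (rule ccontr)
    assume "fst v * snd w \<noteq> snd v * fst w"
    moreover have "a + scale (int k) v + scale (int l) w \<in> V" for k l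
    proof -
      have "a + scale (int l) w + scale (int k) v \<in> desc p"
        by (rule iterate_shift[OF step]) (use lattice subp in auto)
      then show ?thesis using sub(1) by (auto simp: algebra_simps)
    qed
    ultimately show False by (rule no_cone[OF v w])
  qed
  \<comment> \<open>A common multiple of the periods moves \<open>a\<close> to a point that is below
    \<open>a\<close> by the period \<open>w\<close>, and below \<open>p'\<close> by the period
    \<open>v\<close> if \<open>k\<close> is positive. If \<open>k = 0\<close>, then \<open>w\<close>
    would vanish.\<close>
  from parallel_multiples[OF v w v0 this] obtain k l
    where kl: "0 < l" "scale (int k) v = scale (int l) w" by blast
  have in_a: "a + scale (int k) v \<in> desc a" using lattice[of l] kl(2) by simp
  show False
  proof (cases k)
    case 0
    then have "scale (int l) w = 0" using kl(2) by (simp add: scale_def prod_eq_iff)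
    then show False using w0 kl(1) by (auto simp: scale_def prod_eq_iff)
  next
    case (Suc k')
    have "a + scale (int k') v \<in> desc p" by (rule iterate_shift[OF step ap])
    then have "a + scale (int k) v \<in> desc p'"
      using shift Suc by (simp only: scale_Suc add.assoc[symmetric])
    then show False using in_a disj by blast
  qed
qed

end

text \<open>Strict self-assembly enters twice through \<open>ext\<close>: for the seed it gives an
  infinite history, the shape being infinite, and for any reachable assembly it gives confinement to
  the shape.\<close>

lemma no_self_assembly:
  fixes T :: "'l tile set"
  assumes tree: "grid_tree V" and c: "0 < c" and TAS: "is_TAS T \<sigma> \<tau>"
    and ssa: "strictly_self_assembles T \<sigma> \<tau> (scaling c V)"
    and nonneg: "\<And>p. p \<in> V \<Longrightarrow> 0 \<le> fst p \<and> 0 \<le> snd p"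
    and growth: "\<not> linear_growth V"
    and no_cone: "\<And>p v w. \<lbrakk>0 \<le> fst v; 0 \<le> snd v; 0 \<le> fst w; 0 \<le> snd w; fst v * snd w \<noteq> snd v * fst w;
      \<And>k l. p + scale (int k) v + scale (int l) w \<in> V\<rbrakk> \<Longrightarrow> False"
  shows False
proof -
  interpret tile_system T \<sigma> \<tau> using TAS by unfold_locales
  have ext: "\<exists>\<alpha>. dom \<alpha> = scaling c V \<and> \<gamma> \<subseteq>\<^sub>m \<alpha> \<and>
      (finite (dom \<alpha>) \<or> (\<exists>f. f 0 = \<sigma> \<and> (\<forall>i. step1 T \<tau> (f i) (f (Suc i))) \<and> \<alpha> = seq_result f))"
    if "reach \<gamma>" for \<gamma>
    using terminal_extension[OF that] ssa unfolding strictly_self_assembles_def by metis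
  have infV: "infinite V"
  proof
    assume "finite V"
    then have "card (box V N) \<le> card V * Suc N" for N
      using card_mono[of V "box V N"] unfolding box_def by (auto intro: le_trans)
    then show False using growth unfolding linear_growth_def by blast
  qed
  have "scale c ` V \<subseteq> scaling c V"
  proof (rule image_subsetI)
    fix p assume "p \<in> V"
    then show "scale c p \<in> scaling c V" using c unfolding mem_scaling cell_def scale_def by simp
  qed
  moreover have "inj_on (scale c) V" using c by (auto simp: inj_on_def scale_def prod_eq_iff)
  ultimately have inf: "infinite (scaling c V)" using infV by (metis finite_imageD finite_subset)
  have "reach \<sigma>" unfolding reach_def by simp
  from ext[OF this] obtain f where f: "f 0 = \<sigma>" "\<And>i. step1 T \<tau> (f i) (f (Suc i))"
    "dom (seq_result f) = scaling c V"
    using inf by metis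
  obtain r where r: "r \<in> V" using infV by (metis finite.emptyI ex_in_conv)
  interpret tree_assembly T \<sigma> \<tau> V r c f
  proof
    show "dom \<gamma> \<subseteq> scaling c V" if "reach \<gamma>" for \<gamma>
      using ext[OF that] map_le_implies_dom_le by metis
  qed (use tree r c f in auto)
  show False using nonneg growth no_cone by (rule no_tree_assembly)
qed

theorem mainTheorem1:
  fixes TF :: "(nat \<times> nat) set" and c :: int
  assumes "tree_fractal TF" and "0 < c"
  shows "\<not> (\<exists>(T :: 'l tile set) \<sigma> \<tau>. is_TAS T \<sigma> \<tau> \<and>
             strictly_self_assembles T \<sigma> \<tau> (scaling c (embZ ` TF)))"
proof
  assume "\<exists>(T :: 'l tile set) \<sigma> \<tau>. is_TAS T \<sigma> \<tau> \<and>
             strictly_self_assembles T \<sigma> \<tau> (scaling c (embZ ` TF))"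
  then obtain T :: "'l tile set" and \<sigma> \<tau>
    where tas: "is_TAS T \<sigma> \<tau>" "strictly_self_assembles T \<sigma> \<tau> (scaling c (embZ ` TF))" by blast
  have tree: "grid_tree (embZ ` TF)" using assms(1) unfolding tree_fractal_def by simp
  obtain g G where G: "1 < g" "is_generator g G" "TF = (\<Union>i. dssf_stage g G i)"
    using assms(1) unfolding tree_fractal_def is_dssf_def by blast
  interpret generator g G using G by unfold_locales
  have TF: "TF = fractal" using G(3) unfolding fractal_def .
  have conn: "grid_connected (embZ ` fractal)" using tree unfolding grid_tree_def TF by simp
  show False
  proof (rule no_self_assembly[OF tree assms(2) tas])
    show "0 \<le> fst p \<and> 0 \<le> snd p" if "p \<in> embZ ` TF" for p
      using that unfolding embZ_def by auto
    show "\<not> linear_growth (embZ ` TF)"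
    proof
      assume "linear_growth (embZ ` TF)"
      then obtain C where "\<And>N. card (box (embZ ` fractal) N) \<le> C * Suc N"
        unfolding linear_growth_def TF by blast
      moreover obtain N where "C * Suc N < card (box (embZ ` fractal) N)"
        using not_linear[OF conn, of C] unfolding box_def by blast
      ultimately show False by (meson leD)
    qed
    show False
      if "0 \<le> fst v" "0 \<le> snd v" "0 \<le> fst w" "0 \<le> snd w" "fst v * snd w \<noteq> snd v * fst w"
        "\<And>k l. p + scale (int k) v + scale (int l) w \<in> embZ ` TF" for p v w
    proof (rule no_cone[OF that(1-5)])
      fix k l :: nat
      show "(fst p + int k * fst v + int l * fst w, snd p + int k * snd v + int l * snd w) \<in> embZ ` fractal"
        using that(6)[of k l] unfolding TF scale_def plus_prod_def by simp
    qed
  qed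
qed

end
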